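(* Let $(W,S)$ be a finite Coxeter system with Artin–Tits group $B(W)$, and let $\beta\in B(W)$. The following are equivalent: (1) The braid $\beta$ is a rational permutation braid, i.e. $\Delta^{-1}\preccurlyeq\beta\preccurlyeq\Delta$. (2) There exist $\mathbf{x},\mathbf{y}\in\mathbf{W}$ such that $\beta=\mathbf{x}^{-1}\mathbf{y}$. (3) There exist $\mathbf{x},\mathbf{y}\in\mathbf{W}$ such that $\beta=\mathbf{x}\mathbf{y}^{-1}$.
   Context: $B(W)$ is the group generated by a copy $\mathbf{S}=\{\mathbf{s}\mid s\in S\}$ of $S$ subject to the braid relations $\mathbf{s}\mathbf{s}'\mathbf{s}\cdots=\mathbf{s}'\mathbf{s}\mathbf{s}'\cdots$ ($m_{s,s'}$ factors on each side, $m_{s,s'}$ the order of $ss'$ in $W$), and $B^+(W)$ is the submonoid generated by $\mathbf{S}$ (which is the monoid with the same presentation, a Garside monoid). The set $\mathbf{W}\subset B^+(W)$ is the canonical positive lift of $W$: it consists of the elements $\mathbf{w}=\mathbf{s}_{1}\cdots\mathbf{s}_{k}$ where $s_1\cdots s_k$ is a reduced expression (with respect to $S$) of $w\in W$. The Garside element is $\Delta=\mathbf{w}_0$, the lift of the longest element $w_0$ of $W$. For $u,v\in B(W)$ write $u\preccurlyeq v$ if $u^{-1}v\in B^+(W)$; this is a partial order. An element of $B(W)$ is called a rational permutation braid if it lies in the interval $[\Delta^{-1},\Delta]$ for $\preccurlyeq$. *)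

theory Defs
  imports "HOL-Algebra.Multiplicative_Group" "HOL.Hull"
begin

section \<open>Groups given by generators and relations\<close>

text \<open>A letter \<open>(a, True)\<close> stands for the generator \<open>a\<close> and \<open>(a, False)\<close> for its formal
  inverse. A relation \<open>(l, r) \<in> R\<close> is read as the equation \<open>l = r\<close>.\<close>

type_synonym 'a gword = "('a \<times> bool) list"

abbreviation gwords :: "'a set \<Rightarrow> 'a gword set" where
  "gwords S \<equiv> lists (S \<times> UNIV)"

definition pos_word :: "'a list \<Rightarrow> 'a gword" where
  "pos_word ws = map (\<lambda>s. (s, True)) ws"

inductive_set pres_rel :: "'a set \<Rightarrow> ('a gword \<times> 'a gword) set \<Rightarrow> ('a gword \<times> 'a gword) set"
  for S :: "'a set" and R :: "('a gword \<times> 'a gword) set" where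
  refl: "w \<in> gwords S \<Longrightarrow> (w, w) \<in> pres_rel S R"
| sym: "(u, v) \<in> pres_rel S R \<Longrightarrow> (v, u) \<in> pres_rel S R"
| trans: "(u, v) \<in> pres_rel S R \<Longrightarrow> (v, w) \<in> pres_rel S R \<Longrightarrow> (u, w) \<in> pres_rel S R"
| cancel: "u \<in> gwords S \<Longrightarrow> v \<in> gwords S \<Longrightarrow> a \<in> S \<Longrightarrow>
    (u @ [(a, b), (a, \<not> b)] @ v, u @ v) \<in> pres_rel S R"
| rel: "u \<in> gwords S \<Longrightarrow> v \<in> gwords S \<Longrightarrow> l \<in> gwords S \<Longrightarrow> r \<in> gwords S \<Longrightarrow> (l, r) \<in> R \<Longrightarrow>
    (u @ l @ v, u @ r @ v) \<in> pres_rel S R"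

definition presented_group :: "'a set \<Rightarrow> ('a gword \<times> 'a gword) set \<Rightarrow> 'a gword set monoid" where
  "presented_group S R =
    \<lparr>carrier = gwords S // pres_rel S R,
     monoid.mult = (\<lambda>X Y. \<Union>u\<in>X. \<Union>v\<in>Y. pres_rel S R `` {u @ v}),
     one = pres_rel S R `` {[]}\<rparr>"

definition pres_gen :: "'a set \<Rightarrow> ('a gword \<times> 'a gword) set \<Rightarrow> 'a \<Rightarrow> 'a gword set" where
  "pres_gen S R s = pres_rel S R `` {[(s, True)]}"

lemma pres_rel_gwords: "(u, v) \<in> pres_rel S R \<Longrightarrow> u \<in> gwords S \<and> v \<in> gwords S"
  by (induction rule: pres_rel.induct) auto

lemma equiv_pres_rel: "equiv (gwords S) (pres_rel S R)"
proof (rule equivI)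
  show "pres_rel S R \<subseteq> gwords S \<times> gwords S"
    using pres_rel_gwords by (metis SigmaI subrelI)
  show "refl_on (gwords S) (pres_rel S R)"
    by (rule refl_onI) (rule pres_rel.refl)
  show "Relation.sym (pres_rel S R)"
    by (rule symI) (rule pres_rel.sym)
  show "Relation.trans (pres_rel S R)"
    by (rule transI) (rule pres_rel.trans)
qed

lemma pres_rel_context:
  assumes "(u, v) \<in> pres_rel S R" "p \<in> gwords S" "q \<in> gwords S"
  shows "(p @ u @ q, p @ v @ q) \<in> pres_rel S R"
  using assms(1)
proof (induction rule: pres_rel.induct)
  case (refl w)
  then show ?case using assms(2,3) by (intro pres_rel.refl) simp
next
  case (sym u v)
  show ?case by (rule pres_rel.sym) (rule sym.IH)
next
  case (trans u v w)
  show ?case using trans.IH by (rule pres_rel.trans)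
next
  case (cancel u v a b)
  then show ?case using assms(2,3) pres_rel.cancel[of "p @ u" S "v @ q" a b R] by simp
next
  case (rel u v l r)
  then show ?case using assms(2,3) pres_rel.rel[of "p @ u" S "v @ q" l r R] by simp
qed

lemma pres_rel_append:
  assumes "(u, u') \<in> pres_rel S R" "(v, v') \<in> pres_rel S R"
  shows "(u @ v, u' @ v') \<in> pres_rel S R"
proof -
  have "u' \<in> gwords S" "v \<in> gwords S"
    using assms pres_rel_gwords by blast+
  then have "(u @ v, u' @ v) \<in> pres_rel S R" "(u' @ v, u' @ v') \<in> pres_rel S R"
    using pres_rel_context[OF assms(1), of "[]" v] pres_rel_context[OF assms(2), of u' "[]"]
    by simp_all
  then show ?thesis by (rule pres_rel.trans)
qed

lemma mult_presented_group:
  assumes "u \<in> gwords S" "v \<in> gwords S"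
  shows "pres_rel S R `` {u} \<otimes>\<^bsub>presented_group S R\<^esub> pres_rel S R `` {v} = pres_rel S R `` {u @ v}"
proof -
  let ?r = "pres_rel S R"
  have eq: "?r `` {u' @ v'} = ?r `` {u @ v}" if "u' \<in> ?r `` {u}" "v' \<in> ?r `` {v}" for u' v'
    using equiv_class_eq[OF equiv_pres_rel pres_rel_append[of u u' S R v v']] that by simp
  have ne: "u \<in> ?r `` {u}" "v \<in> ?r `` {v}"
    using assms by (simp_all add: pres_rel.refl)
  have "(\<Union>u'\<in>?r `` {u}. \<Union>v'\<in>?r `` {v}. ?r `` {u' @ v'}) =
      (\<Union>u'\<in>?r `` {u}. \<Union>v'\<in>?r `` {v}. ?r `` {u @ v})"
    by (intro SUP_cong HOL.refl eq)
  also have "\<dots> = ?r `` {u @ v}"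
    using ne by blast
  finally show ?thesis
    by (simp add: presented_group_def)
qed

lemma pres_rel_inverse:
  "w \<in> gwords S \<Longrightarrow> (rev (map (\<lambda>(a, b). (a, \<not> b)) w) @ w, []) \<in> pres_rel S R"
proof (induction w)
  case Nil
  show ?case by (simp add: pres_rel.refl)
next
  case (Cons x w)
  obtain a b where x: "x = (a, b)" by fastforce
  let ?i = "rev (map (\<lambda>(a, b). (a, \<not> b)) w)"
  have "a \<in> S" "w \<in> gwords S" "?i \<in> gwords S"
    using Cons.prems x by (auto simp: in_lists_conv_set split_def)
  then have "(?i @ [(a, \<not> b), (a, \<not> \<not> b)] @ w, ?i @ w) \<in> pres_rel S R"
    by (intro pres_rel.cancel)
  moreover have "(?i @ w, []) \<in> pres_rel S R"
    using Cons.IH \<open>w \<in> gwords S\<close> by blast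
  ultimately have "(?i @ [(a, \<not> b), (a, \<not> \<not> b)] @ w, []) \<in> pres_rel S R"
    by (rule pres_rel.trans)
  then show ?case using x by simp
qed

lemma group_presented_group: "group (presented_group S R)"
proof (rule groupI)
  have carr: "\<exists>w\<in>gwords S. X = pres_rel S R `` {w}"
    if "X \<in> carrier (presented_group S R)" for X
    using that by (auto simp: presented_group_def elim: quotientE)
  have cls: "pres_rel S R `` {w} \<in> carrier (presented_group S R)" if "w \<in> gwords S" for w
    using that by (auto simp: presented_group_def intro: quotientI)
  have one: "\<one>\<^bsub>presented_group S R\<^esub> = pres_rel S R `` {[]}"
    by (simp add: presented_group_def)
  show "\<one>\<^bsub>presented_group S R\<^esub> \<in> carrier (presented_group S R)"
    by (simp add: one cls)
  fix X Y assume X: "X \<in> carrier (presented_group S R)"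
  then obtain u where u: "u \<in> gwords S" "X = pres_rel S R `` {u}"
    using carr by blast
  show "\<one>\<^bsub>presented_group S R\<^esub> \<otimes>\<^bsub>presented_group S R\<^esub> X = X"
    using u by (simp add: one mult_presented_group)
  let ?i = "rev (map (\<lambda>(a, b). (a, \<not> b)) u)"
  have i: "?i \<in> gwords S"
    using u(1) by (auto simp: in_lists_conv_set)
  then have "pres_rel S R `` {?i} \<otimes>\<^bsub>presented_group S R\<^esub> X = \<one>\<^bsub>presented_group S R\<^esub>"
    using u equiv_class_eq[OF equiv_pres_rel pres_rel_inverse[OF u(1)]]
    by (simp add: one mult_presented_group)
  then show "\<exists>Z\<in>carrier (presented_group S R).
      Z \<otimes>\<^bsub>presented_group S R\<^esub> X = \<one>\<^bsub>presented_group S R\<^esub>"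
    using cls[OF i] by blast
  assume Y: "Y \<in> carrier (presented_group S R)"
  then obtain v where v: "v \<in> gwords S" "Y = pres_rel S R `` {v}"
    using carr by blast
  show "X \<otimes>\<^bsub>presented_group S R\<^esub> Y \<in> carrier (presented_group S R)"
    using u v by (simp add: mult_presented_group cls)
  fix Z assume "Z \<in> carrier (presented_group S R)"
  then obtain w where w: "w \<in> gwords S" "Z = pres_rel S R `` {w}"
    using carr by blast
  show "X \<otimes>\<^bsub>presented_group S R\<^esub> Y \<otimes>\<^bsub>presented_group S R\<^esub> Z =
      X \<otimes>\<^bsub>presented_group S R\<^esub> (Y \<otimes>\<^bsub>presented_group S R\<^esub> Z)"
    using u v w by (simp add: mult_presented_group)
qed

section \<open>Coxeter systems\<close>

text \<open>The case \<open>s = t\<close> gives the relation \<open>s\<^sup>2 = 1\<close> when \<open>s\<close> has order 2.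
  If \<open>st\<close> has infinite order, then \<open>group.ord\<close> is 0 and the relation is vacuous.\<close>

definition coxeter_rels :: "('a, 'b) monoid_scheme \<Rightarrow> 'a set \<Rightarrow> ('a gword \<times> 'a gword) set" where
  "coxeter_rels W S =
    {(pos_word (concat (replicate (group.ord W (s \<otimes>\<^bsub>W\<^esub> t)) [s, t])), []) | s t. s \<in> S \<and> t \<in> S}"

definition coxeter_system :: "('a, 'b) monoid_scheme \<Rightarrow> 'a set \<Rightarrow> bool" where
  "coxeter_system W S \<longleftrightarrow>
    group W \<and> S \<subseteq> carrier W \<and> (\<forall>s\<in>S. group.ord W s = 2) \<and>
    (\<exists>h \<in> iso (presented_group S (coxeter_rels W S)) W.
       \<forall>s\<in>S. h (pres_gen S (coxeter_rels W S) s) = s)"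

definition list_mult :: "('a, 'b) monoid_scheme \<Rightarrow> 'a list \<Rightarrow> 'a" where
  "list_mult G xs = foldr (\<otimes>\<^bsub>G\<^esub>) xs \<one>\<^bsub>G\<^esub>"

definition cox_length :: "('a, 'b) monoid_scheme \<Rightarrow> 'a set \<Rightarrow> 'a \<Rightarrow> nat" where
  "cox_length W S w = (LEAST n. \<exists>ws\<in>lists S. length ws = n \<and> list_mult W ws = w)"

definition reduced_expr :: "('a, 'b) monoid_scheme \<Rightarrow> 'a set \<Rightarrow> 'a list \<Rightarrow> 'a \<Rightarrow> bool" where
  "reduced_expr W S ws w \<longleftrightarrow>
    ws \<in> lists S \<and> list_mult W ws = w \<and> length ws = cox_length W S w"

definition longest_element :: "('a, 'b) monoid_scheme \<Rightarrow> 'a set \<Rightarrow> 'a" where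
  "longest_element W S =
    (THE w. w \<in> carrier W \<and> (\<forall>v\<in>carrier W. cox_length W S v \<le> cox_length W S w))"

section \<open>Artin--Tits groups\<close>

fun alternating :: "'a \<Rightarrow> 'a \<Rightarrow> nat \<Rightarrow> 'a list" where
  "alternating s t 0 = []"
| "alternating s t (Suc n) = s # alternating t s n"

definition braid_rels :: "('a, 'b) monoid_scheme \<Rightarrow> 'a set \<Rightarrow> ('a gword \<times> 'a gword) set" where
  "braid_rels W S =
    {(pos_word (alternating s t (group.ord W (s \<otimes>\<^bsub>W\<^esub> t))),
      pos_word (alternating t s (group.ord W (s \<otimes>\<^bsub>W\<^esub> t)))) | s t. s \<in> S \<and> t \<in> S \<and> s \<noteq> t}"

definition artin_group :: "('a, 'b) monoid_scheme \<Rightarrow> 'a set \<Rightarrow> 'a gword set monoid" where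
  "artin_group W S = presented_group S (braid_rels W S)"

definition artin_gen :: "('a, 'b) monoid_scheme \<Rightarrow> 'a set \<Rightarrow> 'a \<Rightarrow> 'a gword set" where
  "artin_gen W S = pres_gen S (braid_rels W S)"

definition artin_monoid :: "('a, 'b) monoid_scheme \<Rightarrow> 'a set \<Rightarrow> 'a gword set set" where
  "artin_monoid W S = (\<lambda>M. submonoid M (artin_group W S)) hull (artin_gen W S ` S)"

definition is_lift :: "('a, 'b) monoid_scheme \<Rightarrow> 'a set \<Rightarrow> 'a \<Rightarrow> 'a gword set \<Rightarrow> bool" where
  "is_lift W S w b \<longleftrightarrow>
    (\<exists>ws. reduced_expr W S ws w \<and> b = list_mult (artin_group W S) (map (artin_gen W S) ws))"

definition positive_lifts :: "('a, 'b) monoid_scheme \<Rightarrow> 'a set \<Rightarrow> 'a gword set set" where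
  "positive_lifts W S = {b. \<exists>w\<in>carrier W. is_lift W S w b}"

text \<open>By Matsumoto's theorem every element has exactly one lift.\<close>

definition garside_element :: "('a, 'b) monoid_scheme \<Rightarrow> 'a set \<Rightarrow> 'a gword set" where
  "garside_element W S = (THE b. is_lift W S (longest_element W S) b)"

definition artin_le :: "('a, 'b) monoid_scheme \<Rightarrow> 'a set \<Rightarrow> 'a gword set \<Rightarrow> 'a gword set \<Rightarrow> bool" where
  "artin_le W S u v \<longleftrightarrow> inv\<^bsub>artin_group W S\<^esub> u \<otimes>\<^bsub>artin_group W S\<^esub> v \<in> artin_monoid W S"

definition rational_permutation_braid ::
    "('a, 'b) monoid_scheme \<Rightarrow> 'a set \<Rightarrow> 'a gword set \<Rightarrow> bool" where
  "rational_permutation_braid W S \<beta> \<longleftrightarrow>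
    \<beta> \<in> carrier (artin_group W S) \<and>
    artin_le W S (inv\<^bsub>artin_group W S\<^esub> (garside_element W S)) \<beta> \<and>
    artin_le W S \<beta> (garside_element W S)"

end

theory Submission
  imports Defs
begin

text \<open>
  Positive words up to the braid relations form a monoid, which is analysed through an action on
  pairs \<open>(w, n)\<close> of a group element and a positive word, read as the product \<open>\<^bold>w n\<close>: multiplying
  by \<open>s\<close> on the left replaces \<open>w\<close> by \<open>s h\<close>, where \<open>h\<close> is the largest prefix of \<open>w\<close> in the weak
  order such that \<open>s h\<close> is still length-additive, and moves the remainder \<open>h\<^sup>-\<^sup>1 w\<close> into \<open>n\<close>. Since
  this respects the braid relations, every positive \<open>m\<close> has a simple divisor \<open>\<alpha>(m)\<close> above all its
  other simple divisors, and the monoid is left cancellative. As \<open>\<Delta>\<^sup>2\<close> is central, it then embeds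
  into the Artin group.

  If \<open>s c = \<^bold>x \<^bold>y\<close> with \<open>\<^bold>x\<close> and \<open>\<^bold>y\<close> simple, both \<open>s\<close> and \<open>\<^bold>x\<close> divide \<open>\<alpha>(s c)\<close>, so \<open>c\<close> is again a
  product of two simple braids; hence so is every right divisor of \<open>\<Delta>\<^sup>2\<close>. For a rational permutation
  braid \<open>\<beta>\<close> the positive braids \<open>\<Delta> \<beta>\<close> and \<open>\<beta>\<^sup>-\<^sup>1 \<Delta>\<close> have product \<open>\<Delta>\<^sup>2\<close> in either order, and
  factoring each of them into two simple braids yields the two fractions.
\<close>

section \<open>Products of lists and alternating words\<close>

lemma list_mult_Nil [simp]: "list_mult G [] = \<one>\<^bsub>G\<^esub>"
  by (simp add: list_mult_def)

lemma list_mult_Cons [simp]: "list_mult G (x # xs) = x \<otimes>\<^bsub>G\<^esub> list_mult G xs"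
  by (simp add: list_mult_def)

lemma (in monoid) list_mult_closed [simp, intro]:
  "set xs \<subseteq> carrier G \<Longrightarrow> list_mult G xs \<in> carrier G"
  by (induction xs) auto

lemma (in monoid) list_mult_append:
  "set xs \<subseteq> carrier G \<Longrightarrow> set ys \<subseteq> carrier G \<Longrightarrow>
    list_mult G (xs @ ys) = list_mult G xs \<otimes> list_mult G ys"
  by (induction xs) (auto simp: m_assoc)

lemma (in group) inv_cancel [simp]:
  "x \<in> carrier G \<Longrightarrow> y \<in> carrier G \<Longrightarrow> inv x \<otimes> (x \<otimes> y) = y"
  "x \<in> carrier G \<Longrightarrow> y \<in> carrier G \<Longrightarrow> x \<otimes> (inv x \<otimes> y) = y"
  by (simp_all flip: m_assoc)

lemma alternating_double: "concat (replicate n [s, t]) = alternating s t (2 * n)"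
  by (induction n) auto

lemma length_alternating [simp]: "length (alternating s t n) = n"
  by (induction n arbitrary: s t) auto

lemma set_alternating: "set (alternating s t n) \<subseteq> {s, t}"
  by (induction n arbitrary: s t) auto

lemma take_alternating: "k \<le> n \<Longrightarrow> take k (alternating s t n) = alternating s t k"
proof (induction n arbitrary: s t k)
  case (Suc n)
  then show ?case by (cases k) auto
qed auto

text \<open>The shift by \<open>m\<close> matches the two halves of the range. With \<open>m\<close>
  the order of \<open>st\<close>, this is why the relator \<open>(st)^m\<close> contributes evenly
  to \<open>refl_count\<close>.\<close>

lemma card_periodic_even:
  fixes P :: "nat \<Rightarrow> bool"
  assumes "\<And>i. P (i + m) = P i"
  shows "even (card {i. i < 2 * m \<and> P i})"
proof -
  have eq: "{i. i < 2 * m \<and> P i} = {i. i < m \<and> P i} \<union> (\<lambda>i. i + m) ` {i. i < m \<and> P i}"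
    (is "?A = ?B \<union> ?C")
  proof (intro equalityI subsetI)
    fix i assume i: "i \<in> ?A"
    show "i \<in> ?B \<union> ?C"
    proof (cases "i < m")
      case False
      then have "i = (i - m) + m" "i - m < m" "P (i - m)"
        using i assms[of "i - m"] by auto
      then show ?thesis by blast
    qed (use i in auto)
  qed (use assms in auto)
  have "card ?A = card ?B + card ?C"
    unfolding eq by (rule card_Un_disjoint) auto
  also have "card ?C = card ?B"
    by (rule card_image) auto
  finally show ?thesis by simp
qed

section \<open>Finite Coxeter groups\<close>

locale finite_coxeter =
  fixes W :: "('a, 'b) monoid_scheme" (structure) and S :: "'a set"
  assumes coxeter: "coxeter_system W S" and fin: "finite (carrier W)"
begin

sublocale group W
  using coxeter by (simp add: coxeter_system_def)

abbreviation pr :: "'a list \<Rightarrow> 'a" where "pr \<equiv> list_mult W"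
abbreviation len :: "'a \<Rightarrow> nat" where "len \<equiv> cox_length W S"

lemma S_carrier: "s \<in> S \<Longrightarrow> s \<in> carrier W"
  using coxeter by (auto simp: coxeter_system_def)

lemma lists_carrier: "ws \<in> lists S \<Longrightarrow> set ws \<subseteq> carrier W"
  using S_carrier by auto

lemma pr_closed [simp]: "ws \<in> lists S \<Longrightarrow> pr ws \<in> carrier W"
  using lists_carrier by auto

lemma pr_append: "us \<in> lists S \<Longrightarrow> vs \<in> lists S \<Longrightarrow> pr (us @ vs) = pr us \<otimes> pr vs"
  using lists_carrier by (simp add: list_mult_append)

lemma alternating_lists [simp]: "s \<in> S \<Longrightarrow> t \<in> S \<Longrightarrow> alternating s t n \<in> lists S"
  using set_alternating[of s t n] by auto

lemma sublists_in_lists [simp]: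
  "ws \<in> lists A \<Longrightarrow> rev ws \<in> lists A"
  "ws \<in> lists A \<Longrightarrow> take n ws \<in> lists A"
  "ws \<in> lists A \<Longrightarrow> drop n ws \<in> lists A"
  by (auto simp: in_lists_conv_set dest: in_set_takeD in_set_dropD)

lemma S_square: assumes "s \<in> S" shows "s \<otimes> s = \<one>"
proof -
  have "group.ord W s = 2" using assms coxeter by (auto simp: coxeter_system_def)
  then have "s [^] (2::nat) = \<one>"
    using pow_ord_eq_1[OF S_carrier[OF assms]] by simp
  then show ?thesis using S_carrier[OF assms] by (simp add: numeral_2_eq_2)
qed

lemma S_inv: "s \<in> S \<Longrightarrow> inv s = s"
  using S_square S_carrier inv_equality by blast

lemma S_cancel [simp]: "s \<in> S \<Longrightarrow> g \<in> carrier W \<Longrightarrow> s \<otimes> (s \<otimes> g) = g"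
  using S_square S_carrier by (simp flip: m_assoc)

lemma S_cancel_right [simp]: "s \<in> S \<Longrightarrow> g \<in> carrier W \<Longrightarrow> g \<otimes> s \<otimes> s = g"
  using S_square S_carrier by (simp add: m_assoc)

section \<open>Words modulo the Coxeter presentation\<close>

definition presentation_iso :: "'a gword set \<Rightarrow> 'a" where
  "presentation_iso = (SOME h. h \<in> iso (presented_group S (coxeter_rels W S)) W \<and>
     (\<forall>s\<in>S. h (pres_gen S (coxeter_rels W S) s) = s))"

lemma presentation_iso:
  "presentation_iso \<in> iso (presented_group S (coxeter_rels W S)) W"
  "s \<in> S \<Longrightarrow> presentation_iso (pres_rel S (coxeter_rels W S) `` {[(s, True)]}) = s"
proof -
  have "\<exists>h. h \<in> iso (presented_group S (coxeter_rels W S)) W \<and>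
     (\<forall>s\<in>S. h (pres_gen S (coxeter_rels W S) s) = s)"
    using coxeter by (auto simp: coxeter_system_def)
  from someI_ex[OF this, folded presentation_iso_def]
  show "presentation_iso \<in> iso (presented_group S (coxeter_rels W S)) W"
    "s \<in> S \<Longrightarrow> presentation_iso (pres_rel S (coxeter_rels W S) `` {[(s, True)]}) = s"
    by (auto simp: pres_gen_def)
qed

lemma gword_map_fst: "w \<in> gwords S \<Longrightarrow> map fst w \<in> lists S"
  by (auto simp: in_lists_conv_set)

text \<open>Every generator is an involution, so a letter and its formal inverse have the same image
  and the signs may be dropped.\<close>

lemma presentation_iso_gword:
  assumes "w \<in> gwords S"
  shows "presentation_iso (pres_rel S (coxeter_rels W S) `` {w}) = pr (map fst w)"
proof -
  let ?R = "coxeter_rels W S"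
  let ?r = "pres_rel S ?R" and ?P = "presented_group S ?R"
  interpret P: group ?P by (rule group_presented_group)
  interpret h: group_hom ?P W presentation_iso
    using presentation_iso(1) by unfold_locales (auto simp: iso_def)
  have cls: "?r `` {w} \<in> carrier ?P" if "w \<in> gwords S" for w
    using that by (auto simp: presented_group_def intro: quotientI)
  have one: "\<one>\<^bsub>?P\<^esub> = ?r `` {[]}"
    by (simp add: presented_group_def)
  have letter: "presentation_iso (?r `` {[(a, b)]}) = a" if a: "a \<in> S" for a b
  proof (cases b)
    case False
    have "?r `` {[(a, True)]} \<otimes>\<^bsub>?P\<^esub> ?r `` {[(a, False)]} = \<one>\<^bsub>?P\<^esub>"
      using a mult_presented_group[of "[(a, True)]" S "[(a, False)]" ?R]
        pres_rel.cancel[of "[]" S "[]" a True ?R]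
      by (simp add: one equiv_class_eq[OF equiv_pres_rel])
    then have "a \<otimes> presentation_iso (?r `` {[(a, False)]}) = \<one>"
      using h.hom_mult[of "?r `` {[(a, True)]}" "?r `` {[(a, False)]}"] a
      by (simp add: cls presentation_iso(2))
    then have "presentation_iso (?r `` {[(a, False)]}) = a \<otimes> \<one>"
      using S_cancel[OF a, of "presentation_iso (?r `` {[(a, False)]})"] a cls[of "[(a, False)]"]
      by simp
    then show ?thesis using a False S_carrier by simp
  qed (use a presentation_iso(2) in simp)
  show ?thesis
    using assms
  proof (induction w)
    case Nil
    then show ?case using h.hom_one by (simp add: one)
  next
    case (Cons x w)
    obtain a b where x: "x = (a, b)" by fastforce
    have a: "a \<in> S" and w: "w \<in> gwords S" using Cons.hyps x by auto
    have "?r `` {x # w} = ?r `` {[(a, b)]} \<otimes>\<^bsub>?P\<^esub> ?r `` {w}"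
      using mult_presented_group[of "[(a, b)]" S w ?R] a w unfolding x by simp
    moreover have "presentation_iso (?r `` {[(a, b)]} \<otimes>\<^bsub>?P\<^esub> ?r `` {w}) =
        presentation_iso (?r `` {[(a, b)]}) \<otimes> presentation_iso (?r `` {w})"
      using a w by (intro h.hom_mult cls) auto
    ultimately show ?case
      using w Cons.IH letter[OF a] by (simp add: x)
  qed
qed

text \<open>Injectivity of the isomorphism lets an invariant of group elements be checked on words,
  one defining relation at a time.\<close>

lemma pres_rel_iff_pr_eq:
  assumes "u \<in> gwords S" "v \<in> gwords S"
  shows "(u, v) \<in> pres_rel S (coxeter_rels W S) \<longleftrightarrow> pr (map fst u) = pr (map fst v)"
proof -
  let ?r = "pres_rel S (coxeter_rels W S)"
  have inj: "inj_on presentation_iso (gwords S // ?r)"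
    using presentation_iso(1) by (auto simp: iso_def bij_betw_def presented_group_def)
  have "(u, v) \<in> ?r \<longleftrightarrow> ?r `` {u} = ?r `` {v}"
    using assms by (simp add: eq_equiv_class_iff[OF equiv_pres_rel])
  also have "\<dots> \<longleftrightarrow> presentation_iso (?r `` {u}) = presentation_iso (?r `` {v})"
    using inj assms by (metis inj_on_eq_iff quotientI)
  finally show ?thesis
    using assms by (simp add: presentation_iso_gword)
qed

lemma ex_word: assumes "w \<in> carrier W" shows "\<exists>ws\<in>lists S. pr ws = w"
proof -
  have "presentation_iso ` (gwords S // pres_rel S (coxeter_rels W S)) = carrier W"
    using presentation_iso(1) by (auto simp: iso_def bij_betw_def presented_group_def)
  then obtain u where "u \<in> gwords S" "w = presentation_iso (pres_rel S (coxeter_rels W S) `` {u})"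
    using assms by (auto elim!: quotientE)
  then show ?thesis
    using presentation_iso_gword gword_map_fst by metis
qed

text \<open>The parity of \<open>refl_count ws g\<close> only depends on \<open>pr ws\<close>; it decides whether \<open>g\<close> is a
  left inversion of \<open>pr ws\<close>.\<close>

fun refl_count :: "'a list \<Rightarrow> 'a \<Rightarrow> nat" where
  "refl_count [] g = 0"
| "refl_count (s # ws) g = (if g = s then 1 else 0) + refl_count ws (s \<otimes> g \<otimes> s)"

lemma refl_count_append:
  assumes "us \<in> lists S" "g \<in> carrier W"
  shows "refl_count (us @ vs) g = refl_count us g + refl_count vs (inv (pr us) \<otimes> g \<otimes> pr us)"
  using assms
proof (induction us arbitrary: g)
  case (Cons s us)
  then have s: "s \<in> S" "us \<in> lists S" "s \<in> carrier W" using S_carrier by auto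
  have "inv (pr us) \<otimes> (s \<otimes> g \<otimes> s) \<otimes> pr us = inv (s \<otimes> pr us) \<otimes> g \<otimes> (s \<otimes> pr us)"
    using s Cons.prems by (simp add: inv_mult_group S_inv m_assoc)
  then show ?case using Cons s by simp
qed auto

lemma alternating_conj:
  assumes "s \<in> S" "t \<in> S"
  shows "(s \<otimes> t) [^] n \<otimes> s = s \<otimes> (t \<otimes> s) [^] (n::nat)"
proof (induction n)
  case 0
  then show ?case using assms S_carrier by simp
next
  case (Suc n)
  have "(s \<otimes> t) [^] Suc n \<otimes> s = (s \<otimes> t) [^] n \<otimes> s \<otimes> (t \<otimes> s)"
    using assms S_carrier by (simp add: m_assoc)
  then show ?case
    using Suc assms S_carrier by (simp add: m_assoc)
qed

text \<open>The reflections met along \<open>s t s ...\<close> are \<open>s\<close>,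
  \<open>sts\<close>, \<open>ststs\<close> and so on, that is \<open>(st)^i s\<close>. Conjugation
  by \<open>s\<close> turns those of the tail \<open>t s t ...\<close> into the same list shifted by
  one.\<close>

lemma refl_count_alternating:
  assumes "s \<in> S" "t \<in> S" "g \<in> carrier W"
  shows "refl_count (alternating s t n) g = card {i. i < n \<and> g = (s \<otimes> t) [^] i \<otimes> s}"
  using assms
proof (induction n arbitrary: s t g)
  case (Suc n)
  have c: "s \<in> carrier W" "t \<in> carrier W" using Suc.prems S_carrier by auto
  have eq: "s \<otimes> g \<otimes> s = (t \<otimes> s) [^] i \<otimes> t \<longleftrightarrow> g = (s \<otimes> t) [^] Suc i \<otimes> s" for i :: nat
  proof -
    have "s \<otimes> ((t \<otimes> s) [^] i \<otimes> t) \<otimes> s = (s \<otimes> t) [^] Suc i \<otimes> s"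
      using alternating_conj[OF Suc.prems(1,2), of i, symmetric] c by (simp add: m_assoc[symmetric])
    moreover have "s \<otimes> g \<otimes> s = x \<longleftrightarrow> g = s \<otimes> x \<otimes> s" if "x \<in> carrier W" for x
      using that Suc.prems c by (auto simp: m_assoc S_square)
    ultimately show ?thesis using c by simp
  qed
  have "{i. i < Suc n \<and> g = (s \<otimes> t) [^] i \<otimes> s} =
      {i. i = 0 \<and> g = s} \<union> Suc ` {i. i < n \<and> s \<otimes> g \<otimes> s = (t \<otimes> s) [^] i \<otimes> t}" (is "?A = ?B \<union> ?C")
    unfolding eq using c by (auto simp: less_Suc_eq_0_disj simp del: nat_pow_Suc)
  then have "card ?A = card ?B + card ?C"
    by (simp add: card_Un_disjoint disjoint_iff)
  also have "card ?C = card {i. i < n \<and> s \<otimes> g \<otimes> s = (t \<otimes> s) [^] i \<otimes> t}"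
    by (rule card_image) simp
  also have "card ?B = (if g = s then 1 else 0)"
    by simp
  finally show ?case
    using Suc c by simp
qed auto

lemma pr_alternating_double:
  assumes "s \<in> S" "t \<in> S"
  shows "pr (alternating s t (2 * n)) = (s \<otimes> t) [^] n"
proof (induction n)
  case (Suc n)
  have "pr (alternating s t (2 * Suc n)) = s \<otimes> t \<otimes> (s \<otimes> t) [^] n"
    using assms S_carrier Suc by (simp add: m_assoc)
  then show ?case using assms S_carrier by (metis m_closed nat_pow_Suc2)
qed simp

text \<open>A cancelled pair counts the conjugate of \<open>g\<close> that reaches it twice or not
  at all. A Coxeter relator has \<open>2 * m\<close> letters, \<open>m\<close> the order of
  \<open>st\<close>, and \<open>(st)^i s\<close> has period \<open>m\<close> in \<open>i\<close>, so
  its count is even; its product is trivial, so the count of the rest is unaffected.\<close>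

lemma refl_count_pres_rel:
  assumes "(u, v) \<in> pres_rel S (coxeter_rels W S)" "g \<in> carrier W"
  shows "even (refl_count (map fst u) g) = even (refl_count (map fst v) g)"
  using assms
proof (induction arbitrary: g rule: pres_rel.induct)
  case (cancel u v a b)
  let ?u = "map fst u" and ?v = "map fst v"
  have uv: "?u \<in> lists S" "?v \<in> lists S" "a \<in> carrier W"
    using cancel gword_map_fst S_carrier by auto
  define k where "k = inv (pr ?u) \<otimes> g \<otimes> pr ?u"
  have k: "k \<in> carrier W" using uv cancel by (simp add: k_def)
  have "a \<otimes> (a \<otimes> k \<otimes> a) \<otimes> a = k"
    using uv k \<open>a \<in> S\<close> by (simp add: m_assoc S_square)
  moreover have "a \<otimes> k \<otimes> a = a \<longleftrightarrow> k = a"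
    using uv k \<open>a \<in> S\<close> by (metis S_cancel S_cancel_right S_square l_one m_closed)
  ultimately show ?case
    using uv cancel by (simp add: refl_count_append k_def[symmetric])
next
  case (rel u v l r)
  obtain s t where st: "s \<in> S" "t \<in> S"
    "l = pos_word (concat (replicate (group.ord W (s \<otimes> t)) [s, t]))" "r = []"
    using rel by (auto simp: coxeter_rels_def)
  let ?m = "group.ord W (s \<otimes> t)"
  have l: "map fst l = alternating s t (2 * ?m)"
    by (simp add: st alternating_double pos_word_def comp_def)
  have c: "s \<otimes> t \<in> carrier W" using st S_carrier by simp
  have one: "pr (map fst l) = \<one>"
    using pr_alternating_double[OF st(1,2), of ?m] pow_ord_eq_1[OF c] by (simp add: l)
  have even: "even (refl_count (map fst l) k)" if k: "k \<in> carrier W" for k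
  proof -
    have "(s \<otimes> t) [^] (i + ?m) = (s \<otimes> t) [^] i" for i
      using c pow_ord_eq_1[OF c] by (simp flip: nat_pow_mult)
    then show ?thesis
      unfolding l refl_count_alternating[OF st(1,2) k] by (intro card_periodic_even) simp
  qed
  have uv: "map fst u \<in> lists S" "map fst v \<in> lists S" "map fst l \<in> lists S"
    using rel gword_map_fst by blast+
  show ?case
    using uv rel one even st(4) by (simp add: refl_count_append inv_mult_group)
qed auto

lemma refl_count_eq:
  assumes "us \<in> lists S" "vs \<in> lists S" "pr us = pr vs" "g \<in> carrier W"
  shows "even (refl_count us g) = even (refl_count vs g)"
proof -
  have "pos_word us \<in> gwords S" "pos_word vs \<in> gwords S"
    "map fst (pos_word us) = us" "map fst (pos_word vs) = vs"
    using assms by (auto simp: pos_word_def comp_def in_lists_conv_set)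
  then show ?thesis
    using refl_count_pres_rel[of "pos_word us" "pos_word vs"] pres_rel_iff_pr_eq assms by auto
qed

text \<open>At a letter \<open>s\<close> behind a prefix \<open>p\<close>, the count increases
  exactly when \<open>g\<close> is the reflection \<open>p s p^-1\<close>, which is the equation
  \<open>g p = p s\<close>.\<close>

lemma refl_count_pos:
  assumes "ws \<in> lists S" "g \<in> carrier W" "refl_count ws g > 0"
  shows "\<exists>i<length ws. g \<otimes> pr (take i ws) = pr (take (Suc i) ws)"
  using assms
proof (induction ws arbitrary: g)
  case (Cons s ws)
  then have s: "s \<in> S" "ws \<in> lists S" "s \<in> carrier W" using S_carrier by auto
  show ?case
  proof (cases "g = s")
    case False
    then obtain i where i: "i < length ws" "s \<otimes> g \<otimes> s \<otimes> pr (take i ws) = pr (take (Suc i) ws)"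
      using Cons.IH[of "s \<otimes> g \<otimes> s"] Cons.prems s by auto
    have tk: "take i ws \<in> lists S" using s(2) by (auto dest: in_set_takeD)
    have "s \<otimes> (s \<otimes> g \<otimes> s \<otimes> pr (take i ws)) = g \<otimes> (s \<otimes> pr (take i ws))"
      using s Cons.prems tk by (simp add: m_assoc)
    then have "g \<otimes> pr (take (Suc i) (s # ws)) = pr (take (Suc (Suc i)) (s # ws))"
      using i(2) by simp
    then show ?thesis using i(1) by (intro exI[of _ "Suc i"]) simp
  qed (use s in auto)
qed auto

section \<open>Word length and the exchange condition\<close>

lemma len_le: "ws \<in> lists S \<Longrightarrow> len (pr ws) \<le> length ws"
  unfolding cox_length_def by (rule Least_le) blast

definition reduced :: "'a list \<Rightarrow> bool" where
  "reduced ws \<longleftrightarrow> ws \<in> lists S \<and> length ws = len (pr ws)"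

lemma reduced_expr_iff: "reduced_expr W S ws w \<longleftrightarrow> reduced ws \<and> pr ws = w"
  by (auto simp: reduced_expr_def reduced_def)

lemma ex_reduced:
  assumes "w \<in> carrier W"
  shows "\<exists>ws. reduced ws \<and> pr ws = w"
proof -
  have "\<exists>n. \<exists>ws\<in>lists S. length ws = n \<and> pr ws = w"
    using ex_word[OF assms] by blast
  from LeastI_ex[OF this] show ?thesis
    by (auto simp: reduced_def cox_length_def)
qed

definition rw :: "'a \<Rightarrow> 'a list" where
  "rw w = (SOME ws. reduced ws \<and> pr ws = w)"

lemma rw: assumes "w \<in> carrier W"
  shows "reduced (rw w)" "pr (rw w) = w" "rw w \<in> lists S" "length (rw w) = len w"
  using someI_ex[OF ex_reduced[OF assms], folded rw_def] by (auto simp: reduced_def)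

lemma len_mult: assumes "x \<in> carrier W" "y \<in> carrier W"
  shows "len (x \<otimes> y) \<le> len x + len y"
  using len_le[of "rw x @ rw y"] rw[of x] rw[of y] assms by (simp add: pr_append)

lemma len_one [simp]: "len \<one> = 0"
  using len_le[of "[]"] by simp

lemma len_zero: "w \<in> carrier W \<Longrightarrow> len w = 0 \<Longrightarrow> w = \<one>"
  using rw[of w] by simp

lemma pr_rev: "ws \<in> lists S \<Longrightarrow> pr (rev ws) = inv (pr ws)"
proof (induction ws)
  case (Cons s ws)
  then show ?case
    using pr_append[of "rev ws" "[s]"] S_carrier by (simp add: inv_mult_group S_inv)
qed simp

lemma len_inv [simp]: assumes "w \<in> carrier W" shows "len (inv w) = len w"
proof -
  have "len (inv w) \<le> len w" if w: "w \<in> carrier W" for w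
    using len_le[of "rev (rw w)"] rw[OF w] pr_rev[of "rw w"] by simp
  from this[OF assms] this[of "inv w"] assms show ?thesis by simp
qed

text \<open>The hypothesis says that \<open>s\<close> in front of the prefix before position
  \<open>i\<close> acts like the letter at \<open>i\<close> behind it. As \<open>s\<close> is an
  involution, multiplying by \<open>s\<close> removes that letter.\<close>

lemma delete_letter:
  assumes "ws \<in> lists S" "s \<in> S" "i < length ws" "s \<otimes> pr (take i ws) = pr (take (Suc i) ws)"
  shows "s \<otimes> pr ws = pr (take i ws @ drop (Suc i) ws)"
proof -
  have tk: "take k ws \<in> lists S" "drop k ws \<in> lists S" for k
    using assms(1) by (auto dest: in_set_takeD in_set_dropD)
  have "pr ws = pr (take (Suc i) ws) \<otimes> pr (drop (Suc i) ws)"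
    using pr_append[OF tk(1) tk(2), of "Suc i" "Suc i"] by simp
  also have "\<dots> = s \<otimes> pr (take i ws @ drop (Suc i) ws)"
    using assms tk S_carrier by (simp add: pr_append m_assoc flip: assms(4))
  finally show ?thesis using assms tk by simp
qed

lemma refl_count_odd_len:
  assumes "s \<in> S" "ws \<in> lists S" "odd (refl_count ws s)"
  shows "len (s \<otimes> pr ws) < len (pr ws)"
proof -
  let ?ws = "rw (pr ws)"
  have r: "?ws \<in> lists S" "pr ?ws = pr ws" "length ?ws = len (pr ws)"
    using rw[of "pr ws"] assms by auto
  \<comment> \<open>Parity does not depend on the word chosen, so a reduced one may be used;
    deleting a letter from it gives the strict drop.\<close>
  have "odd (refl_count ?ws s)"
    using refl_count_eq[OF r(1) assms(2) r(2), of s] assms S_carrier by simp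
  then have "refl_count ?ws s > 0" by (simp add: odd_pos)
  then obtain i where i: "i < length ?ws" "s \<otimes> pr (take i ?ws) = pr (take (Suc i) ?ws)"
    using refl_count_pos[OF r(1)] assms S_carrier by blast
  have "len (s \<otimes> pr ws) \<le> length (take i ?ws @ drop (Suc i) ?ws)"
    using delete_letter[OF r(1) assms(1) i] r
    by (metis append_in_lists_conv append_take_drop_id len_le)
  then show ?thesis using i r by simp
qed

text \<open>Prefixing \<open>s\<close> adds one to the count at \<open>s\<close>, so the count is
  odd for exactly one of \<open>w\<close> and \<open>s w\<close>, and the length drops strictly in
  one direction. Subadditivity bounds the change by one.\<close>

lemma len_Cons:
  assumes "s \<in> S" "w \<in> carrier W"
  shows "len (s \<otimes> w) = Suc (len w) \<or> Suc (len (s \<otimes> w)) = len w"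
proof -
  have s: "s \<in> carrier W" using assms S_carrier by simp
  have r: "rw w \<in> lists S" "pr (rw w) = w" using rw assms by auto
  have "s \<otimes> s \<otimes> s = s" using assms s by simp
  then have "len w \<noteq> len (s \<otimes> w)"
    using refl_count_odd_len[of s "rw w"] refl_count_odd_len[of s "s # rw w"] assms r s
    by (cases "odd (refl_count (rw w) s)") auto
  moreover have "len s \<le> Suc 0" using len_le[of "[s]"] assms s by simp
  moreover have "len (s \<otimes> w) \<le> len s + len w" "len (s \<otimes> (s \<otimes> w)) \<le> len s + len (s \<otimes> w)"
    using assms s by (intro len_mult; simp)+
  moreover have "len (s \<otimes> (s \<otimes> w)) = len w" using assms by simp
  ultimately show ?thesis by linarith
qed

lemma exchange:
  assumes "s \<in> S" "ws \<in> lists S" "len (s \<otimes> pr ws) \<le> len (pr ws)"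
  shows "\<exists>i<length ws. s \<otimes> pr (take i ws) = pr (take (Suc i) ws)"
proof -
  have s: "s \<in> carrier W" using assms S_carrier by simp
  have "s \<otimes> s \<otimes> s = s" using assms s by simp
  \<comment> \<open>If the count were even, it would be odd for \<open>s # ws\<close>, and
    \<open>pr ws\<close> would be strictly shorter than its product with \<open>s\<close>.\<close>
  then have "odd (refl_count ws s)"
    using refl_count_odd_len[of s "s # ws"] assms s by auto
  then show ?thesis
    using refl_count_pos[OF assms(2) s] by (simp add: odd_pos)
qed

lemma reduced_lists: "reduced ws \<Longrightarrow> ws \<in> lists S"
  by (simp add: reduced_def)

lemma reduced_closed [simp]: "reduced ws \<Longrightarrow> pr ws \<in> carrier W"
  by (simp add: reduced_def)

lemma reducedI: "ws \<in> lists S \<Longrightarrow> length ws \<le> len (pr ws) \<Longrightarrow> reduced ws"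
  using len_le[of ws] by (simp add: reduced_def)

lemma reduced_Nil [simp]: "reduced []"
  by (simp add: reduced_def)

lemma reduced_singleton: assumes "s \<in> S" shows "reduced [s]"
proof -
  have "len (s \<otimes> \<one>) \<noteq> 0" using len_Cons[OF assms, of \<one>] by auto
  then show ?thesis using assms by (intro reducedI) auto
qed

lemma len_S: "s \<in> S \<Longrightarrow> len s = 1"
  using reduced_singleton[of s] S_carrier by (simp add: reduced_def)

lemma reduced_appendD:
  assumes "reduced (us @ vs)"
  shows "reduced us" "reduced vs" "len (pr us \<otimes> pr vs) = len (pr us) + len (pr vs)"
proof -
  have l: "us \<in> lists S" "vs \<in> lists S"
    and r: "length us + length vs = len (pr us \<otimes> pr vs)"
    using assms pr_append[of us vs] by (auto simp: reduced_def)
  have "length us + length vs \<le> len (pr us) + len (pr vs)"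
    using l len_mult[of "pr us" "pr vs"] r by simp
  with len_le[OF l(1)] len_le[OF l(2)] l r
  show "reduced us" "reduced vs" "len (pr us \<otimes> pr vs) = len (pr us) + len (pr vs)"
    by (auto simp: reduced_def)
qed

lemma reduced_appendI:
  assumes "reduced us" "reduced vs" "len (pr us \<otimes> pr vs) = len (pr us) + len (pr vs)"
  shows "reduced (us @ vs)"
  using assms by (auto simp: reduced_def pr_append)

lemma pr_append': "reduced (us @ vs) \<Longrightarrow> pr (us @ vs) = pr us \<otimes> pr vs"
  by (simp add: reduced_def pr_append)

lemma reduced_same_length:
  "reduced us \<Longrightarrow> vs \<in> lists S \<Longrightarrow> pr us = pr vs \<Longrightarrow> length vs = length us \<Longrightarrow> reduced vs"
  by (simp add: reduced_def)

text \<open>The exchanged letter cannot lie in \<open>us\<close>, because \<open>s # us\<close> is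
  reduced. It is therefore removed from \<open>vs\<close>, and \<open>us\<close> stays intact:
  prescribed prefixes can be built one letter at a time.\<close>

lemma exchange_append:
  assumes "reduced (us @ vs)" "reduced (s # us)" "len (s \<otimes> pr (us @ vs)) < len (pr (us @ vs))"
  shows "\<exists>vs'. reduced (s # us @ vs') \<and> pr (s # us @ vs') = pr (us @ vs)"
proof -
  have l: "us \<in> lists S" "vs \<in> lists S" "us @ vs \<in> lists S" and s: "s \<in> S"
    using assms by (auto simp: reduced_def)
  obtain i where i: "i < length (us @ vs)"
      "s \<otimes> pr (take i (us @ vs)) = pr (take (Suc i) (us @ vs))"
    using exchange[OF s l(3)] assms by auto
  have del: "s \<otimes> pr (us @ vs) = pr (take i (us @ vs) @ drop (Suc i) (us @ vs))"
    by (rule delete_letter[OF l(3) s i])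
  have "length us \<le> i"
  proof (rule ccontr)
    assume "\<not> length us \<le> i"
    then have j: "i < length us" "s \<otimes> pr (take i us) = pr (take (Suc i) us)"
      using i by auto
    have "len (pr (s # us)) \<le> length (take i us @ drop (Suc i) us)"
      using delete_letter[OF l(1) s j] l
        len_le[of "take i us @ drop (Suc i) us"] by simp
    moreover have "length (take i us @ drop (Suc i) us) < length us" using j by simp
    ultimately show False using assms(2) by (simp add: reduced_def)
  qed
  define j where "j = i - length us"
  define vs' where "vs' = take j vs @ drop (Suc j) vs"
  have j: "j < length vs" using i \<open>length us \<le> i\<close> by (auto simp: j_def)
  have vs': "vs' \<in> lists S" using l by (simp add: vs'_def)
  have "s \<otimes> pr (us @ vs) = pr (us @ vs')"
    using del \<open>length us \<le> i\<close> by (simp add: vs'_def j_def Suc_diff_le)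
  moreover have "pr (us @ vs) \<in> carrier W" using l by simp
  ultimately have eq: "pr (s # us @ vs') = pr (us @ vs)"
    using s by (metis S_cancel list_mult_Cons)
  moreover have "reduced (s # us @ vs')"
    using assms(1) j by (rule_tac reduced_same_length[of "us @ vs"]) (use eq s l vs' in \<open>auto simp: vs'_def\<close>)
  ultimately show ?thesis by blast
qed

subsection \<open>Dihedral subgroups\<close>

abbreviation cox_ord :: "'a \<Rightarrow> 'a \<Rightarrow> nat" where "cox_ord s t \<equiv> group.ord W (s \<otimes> t)"

lemma cox_ord_commute: assumes "s \<in> S" "t \<in> S" shows "cox_ord t s = cox_ord s t"
proof -
  have "t \<otimes> s = inv (s \<otimes> t)" using assms S_carrier by (simp add: inv_mult_group S_inv)
  then show ?thesis using assms S_carrier by (simp add: ord_inv)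
qed

lemma cox_ord_pos: assumes "s \<in> S" "t \<in> S" shows "cox_ord s t > 0"
  using assms S_carrier ord_ge_1[OF fin, of "s \<otimes> t"] by simp

lemma pr_alternating_quotient:
  assumes "s \<in> S" "t \<in> S"
  shows "pr (alternating s t n) \<otimes> inv (pr (alternating t s n)) = (s \<otimes> t) [^] n"
  using assms
proof (induction n arbitrary: s t)
  case (Suc n)
  have c: "s \<in> carrier W" "t \<in> carrier W" using Suc.prems S_carrier by auto
  let ?a = "pr (alternating s t n)" and ?b = "pr (alternating t s n)"
  have ab: "?a \<in> carrier W" "?b \<in> carrier W" using Suc.prems by auto
  have "pr (alternating s t (Suc n)) \<otimes> inv (pr (alternating t s (Suc n))) = s \<otimes> (?b \<otimes> inv ?a) \<otimes> t"
    using Suc.prems c ab by (simp add: inv_mult_group S_inv m_assoc)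
  also have "\<dots> = s \<otimes> (t \<otimes> s) [^] n \<otimes> t"
    using Suc.IH[of t s] Suc.prems by simp
  also have "\<dots> = (s \<otimes> t) [^] n \<otimes> s \<otimes> t"
    using alternating_conj[OF Suc.prems, of n] by simp
  finally show ?case using c by (simp add: m_assoc)
qed simp

lemma pr_alternating_eq_iff:
  assumes "s \<in> S" "t \<in> S"
  shows "pr (alternating s t n) = pr (alternating t s n) \<longleftrightarrow> cox_ord s t dvd n"
proof -
  let ?a = "pr (alternating s t n)" and ?b = "pr (alternating t s n)"
  have ab: "?a \<in> carrier W" "?b \<in> carrier W" using assms by auto
  have "?a = ?b \<longleftrightarrow> ?a \<otimes> inv ?b = \<one>"
    using ab by (metis inv_closed inv_equality inv_inv r_inv)
  also have "\<dots> \<longleftrightarrow> cox_ord s t dvd n"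
    using assms S_carrier pr_alternating_quotient[OF assms] by (simp add: pow_eq_id)
  finally show ?thesis .
qed

text \<open>If a further letter failed to lengthen the word, exchange would equate the two
  alternating words of some positive length below the order of \<open>st\<close>.\<close>

lemma reduced_alternating:
  assumes "s \<in> S" "t \<in> S" "s \<noteq> t" "k \<le> cox_ord s t"
  shows "reduced (alternating s t k)"
  using assms
proof (induction k arbitrary: s t)
  case (Suc k)
  let ?ws = "alternating t s k"
  have r: "reduced ?ws" "?ws \<in> lists S"
    using Suc cox_ord_commute[of s t] by auto
  show ?case
  proof (rule reducedI)
    show "length (alternating s t (Suc k)) \<le> len (pr (alternating s t (Suc k)))"
    proof (rule ccontr)
      assume "\<not> ?thesis"
      then have "len (s \<otimes> pr ?ws) \<le> len (pr ?ws)"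
        using r by (simp add: reduced_def)
      then obtain i where i: "i < k" "s \<otimes> pr (take i ?ws) = pr (take (Suc i) ?ws)"
        using exchange[OF Suc.prems(1) r(2)] by auto
      then have "pr (alternating s t (Suc i)) = pr (alternating t s (Suc i))"
        using take_alternating[of i k t s] take_alternating[of "Suc i" k t s] by simp
      then have "cox_ord s t dvd Suc i"
        using pr_alternating_eq_iff Suc.prems by blast
      then show False using i Suc.prems by (auto dest: dvd_imp_le)
    qed
  qed (use Suc.prems in simp)
qed simp

text \<open>Both letters are left descents of \<open>w\<close>, so \<open>exchange_append\<close>
  can prepend them in turn as long as the alternating word stays reduced, which holds up to the
  order of \<open>st\<close>.\<close>

lemma dihedral_prefix:
  assumes "s \<in> S" "t \<in> S" "s \<noteq> t" "w \<in> carrier W"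
    and "len (s \<otimes> w) < len w" "len (t \<otimes> w) < len w" and "k \<le> cox_ord s t"
  shows "\<exists>zs. reduced (alternating s t k @ zs) \<and> pr (alternating s t k @ zs) = w"
  using assms
proof (induction k arbitrary: s t)
  case 0
  then show ?case using rw[of w] by auto
next
  case (Suc k)
  have "k \<le> cox_ord t s"
    using Suc.prems(7) cox_ord_commute[OF Suc.prems(1,2)] by simp
  then obtain zs where zs: "reduced (alternating t s k @ zs)" "pr (alternating t s k @ zs) = w"
    using Suc.IH[OF Suc.prems(2,1) not_sym[OF Suc.prems(3)] Suc.prems(4,6,5)] by blast
  have "reduced (s # alternating t s k)"
    using reduced_alternating[of s t "Suc k"] Suc.prems by simp
  from exchange_append[OF zs(1) this] zs(2) Suc.prems show ?case by auto
qed

subsection \<open>The braid congruence on words and Matsumoto's theorem\<close>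

text \<open>The context words range over all lists, so that reflexivity and the context rules carry
  no side conditions; \<open>braid_cong_lists\<close> transfers membership in \<open>lists S\<close>
  when it is needed.\<close>

inductive braid_cong :: "'a list \<Rightarrow> 'a list \<Rightarrow> bool" (infix "\<simeq>" 50) where
  braid: "s \<in> S \<Longrightarrow> t \<in> S \<Longrightarrow> s \<noteq> t \<Longrightarrow>
    us @ alternating s t (cox_ord s t) @ vs \<simeq> us @ alternating t s (cox_ord s t) @ vs"
| refl [simp]: "us \<simeq> us"
| sym: "us \<simeq> vs \<Longrightarrow> vs \<simeq> us"
| trans [trans]: "us \<simeq> vs \<Longrightarrow> vs \<simeq> ws \<Longrightarrow> us \<simeq> ws"

lemma braid_cong_context: "us \<simeq> vs \<Longrightarrow> ps @ us @ qs \<simeq> ps @ vs @ qs"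
proof (induction rule: braid_cong.induct)
  case (braid s t us vs)
  then show ?case using braid_cong.braid[of s t "ps @ us" "vs @ qs"] by simp
qed (auto intro: braid_cong.sym braid_cong.trans)

lemma braid_cong_append: "us \<simeq> us' \<Longrightarrow> vs \<simeq> vs' \<Longrightarrow> us @ vs \<simeq> us' @ vs'"
  using braid_cong_context[of us us' "[]" vs] braid_cong_context[of vs vs' us' "[]"]
    braid_cong.trans by simp

lemma braid_cong_Cons: "us \<simeq> us' \<Longrightarrow> s # us \<simeq> s # us'"
  using braid_cong_append[of "[s]" "[s]"] by simp

lemma braid_cong_lists: "us \<simeq> vs \<Longrightarrow> us \<in> lists S \<longleftrightarrow> vs \<in> lists S"
  by (induction rule: braid_cong.induct) auto

lemma braid_cong_length: "us \<simeq> vs \<Longrightarrow> length us = length vs"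
  by (induction rule: braid_cong.induct) auto

lemma braid_cong_pr: "us \<simeq> vs \<Longrightarrow> us \<in> lists S \<Longrightarrow> pr us = pr vs"
proof (induction rule: braid_cong.induct)
  case (braid s t us vs)
  then show ?case using pr_alternating_eq_iff[of s t "cox_ord s t"] by (simp add: pr_append)
qed (auto simp: braid_cong_lists)

lemma braid_cong_reduced: "us \<simeq> vs \<Longrightarrow> reduced us \<Longrightarrow> reduced vs"
  using braid_cong_lists braid_cong_length braid_cong_pr unfolding reduced_def by metis

text \<open>Words with equal first letter reduce to their tails. If the first letters
  \<open>s\<close> and \<open>t\<close> differ, both are left descents, so the element also has
  reduced words starting with either full alternating word; these two differ by one braid move, and
  each shares its first letter with one of the given words.\<close>

theorem Matsumoto:
  assumes "reduced us" "reduced vs" "pr us = pr vs"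
  shows "us \<simeq> vs"
  using assms
proof (induction "length us" arbitrary: us vs)
  case 0
  then have "us = []" "length vs = len (pr us)" by (simp_all add: reduced_def)
  then show ?case by simp
next
  case (Suc n)
  have len: "length us = Suc n" "length vs = Suc n" using Suc by (auto simp: reduced_def)
  then obtain s us' t vs' where us: "us = s # us'" and vs: "vs = t # vs'"
    by (meson length_Suc_conv)
  have st: "s \<in> S" "t \<in> S" using Suc.prems us vs by (auto simp: reduced_def)
  have head: "xs \<simeq> ys" if "xs = x # xs'" "ys = x # ys'" "length xs = Suc n"
    "reduced xs" "reduced ys" "pr xs = pr ys" for x xs xs' ys ys'
  proof -
    have "reduced xs'" "reduced ys'" and x: "x \<in> S"
      using that reduced_appendD(2)[of "[x]"] by (auto simp: reduced_def)
    moreover from this have "pr xs' = pr ys'"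
      using that S_carrier by (simp add: reduced_def)
    ultimately show ?thesis using that Suc.hyps(1)[of xs' ys'] by (simp add: braid_cong_Cons)
  qed
  show ?case
  proof (cases "s = t")
    case True
    then show ?thesis using head us vs len Suc.prems by blast
  next
    case False
    let ?m = "cox_ord s t" and ?w = "pr us"
    have w: "?w \<in> carrier W" "len ?w = Suc n" using Suc.prems len by (auto simp: reduced_def)
    have c: "us' \<in> lists S" "vs' \<in> lists S" using Suc.prems us vs by (auto simp: reduced_def)
    have "s \<otimes> pr us = pr us'" "t \<otimes> pr vs = pr vs'"
      unfolding us vs list_mult_Cons by (intro S_cancel st pr_closed c)+
    then have eq: "s \<otimes> ?w = pr us'" "t \<otimes> ?w = pr vs'"
      unfolding Suc.prems(3) .
    have "length us' < len ?w" "length vs' < len ?w" using w(2) len us vs by simp_all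
    then have "len (s \<otimes> ?w) < len ?w" "len (t \<otimes> ?w) < len ?w"
      using len_le[OF c(1)] len_le[OF c(2)] unfolding eq by linarith+
    from dihedral_prefix[OF st False w(1) this order.refl]
    obtain zs where zs: "reduced (alternating s t ?m @ zs)" "pr (alternating s t ?m @ zs) = ?w"
      by blast
    have br: "alternating s t ?m @ zs \<simeq> alternating t s ?m @ zs"
      using braid_cong.braid[OF st False, of "[]" zs] by simp
    have zs': "reduced (alternating t s ?m @ zs)" "pr (alternating t s ?m @ zs) = ?w"
      using braid_cong_reduced[OF br zs(1)] braid_cong_pr[OF br reduced_lists[OF zs(1)]] zs(2)
      by simp_all
    \<comment> \<open>A positive order makes both alternating words non-empty, which exposes the
      first letters that \<open>head\<close> compares.\<close>
    obtain m where m: "?m = Suc m"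
      using cox_ord_pos[OF st] gr0_conv_Suc by auto
    have "us \<simeq> alternating s t ?m @ zs"
      by (rule head[OF us _ len(1) Suc.prems(1) zs(1)]) (simp add: m, simp only: zs(2))
    also note br
    also have "alternating t s ?m @ zs \<simeq> vs"
      by (rule braid_cong.sym[OF head[OF vs _ len(2) Suc.prems(2) zs'(1)]])
        (simp add: m, simp only: zs'(2) Suc.prems(3))
    finally show ?thesis .
  qed
qed

subsection \<open>The weak order\<close>

text \<open>This is the right weak order: \<open>u\<close> is the product of an initial segment of
  some reduced word of \<open>w\<close>.\<close>

definition pre :: "'a \<Rightarrow> 'a \<Rightarrow> bool" where
  "pre u w \<longleftrightarrow> u \<in> carrier W \<and> w \<in> carrier W \<and> len w = len u + len (inv u \<otimes> w)"

lemma pre_carrier: "pre u w \<Longrightarrow> u \<in> carrier W" "pre u w \<Longrightarrow> w \<in> carrier W"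
  by (auto simp: pre_def)

lemma pre_mult_iff:
  "u \<in> carrier W \<Longrightarrow> v \<in> carrier W \<Longrightarrow> pre u (u \<otimes> v) \<longleftrightarrow> len (u \<otimes> v) = len u + len v"
  by (simp add: pre_def)

lemma preE:
  assumes "pre u w"
  obtains v where "v \<in> carrier W" "w = u \<otimes> v" "len (u \<otimes> v) = len u + len v"
proof (rule that)
  show "inv u \<otimes> w \<in> carrier W" "w = u \<otimes> (inv u \<otimes> w)"
    "len (u \<otimes> (inv u \<otimes> w)) = len u + len (inv u \<otimes> w)"
    using assms by (auto simp: pre_def)
qed

lemma pre_one [simp]: "w \<in> carrier W \<Longrightarrow> pre \<one> w"
  by (simp add: pre_def)

lemma pre_refl [simp]: "w \<in> carrier W \<Longrightarrow> pre w w"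
  by (simp add: pre_def)

lemma pre_len: "pre u w \<Longrightarrow> len u \<le> len w"
  by (simp add: pre_def)

lemma pre_len_eq: assumes "pre u w" "len w \<le> len u" shows "u = w"
proof -
  obtain v where v: "v \<in> carrier W" "w = u \<otimes> v" "len v = 0"
    using assms by (elim preE) auto
  then show ?thesis using len_zero[of v] pre_carrier[OF assms(1)] by simp
qed

text \<open>With \<open>z = v y\<close>, subadditivity for \<open>x v\<close> and for
  \<open>(x v) y\<close> leaves no slack once the total length is additive.\<close>

lemma pre_mult_left:
  assumes "x \<in> carrier W" "pre v z" "len (x \<otimes> z) = len x + len z"
  shows "len (x \<otimes> v) = len x + len v" "pre (x \<otimes> v) (x \<otimes> z)"
proof -
  from assms(2) obtain y where y: "y \<in> carrier W" "z = v \<otimes> y" "len (v \<otimes> y) = len v + len y"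
    by (rule preE)
  have v: "v \<in> carrier W" using assms(2) pre_carrier by blast
  have "len (x \<otimes> v \<otimes> y) \<le> len (x \<otimes> v) + len y" "len (x \<otimes> v) \<le> len x + len v"
    using assms y v by (intro len_mult; simp)+
  moreover have eq: "x \<otimes> z = x \<otimes> v \<otimes> y" using assms y v by (simp add: m_assoc)
  ultimately show l: "len (x \<otimes> v) = len x + len v"
    using assms y by simp
  show "pre (x \<otimes> v) (x \<otimes> z)"
    unfolding eq using assms y v l eq by (subst pre_mult_iff) auto
qed

lemma pre_mult_leftD:
  assumes "x \<in> carrier W" "v \<in> carrier W" "z \<in> carrier W" "pre (x \<otimes> v) (x \<otimes> z)"
    "len (x \<otimes> z) = len x + len z" "len (x \<otimes> v) = len x + len v"
  shows "pre v z"
proof -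
  have "inv (x \<otimes> v) \<otimes> (x \<otimes> z) = inv v \<otimes> z"
    using assms by (simp add: inv_mult_group m_assoc)
  then show ?thesis using assms by (simp add: pre_def)
qed

lemma pre_trans [trans]:
  assumes "pre u v" "pre v w"
  shows "pre u w"
proof -
  from assms(1) obtain a where a: "a \<in> carrier W" "v = u \<otimes> a" "len (u \<otimes> a) = len u + len a"
    by (rule preE)
  from assms(2) obtain b where b: "b \<in> carrier W" "w = v \<otimes> b" "len (v \<otimes> b) = len v + len b"
    by (rule preE)
  have u: "u \<in> carrier W" using assms pre_carrier by blast
  have w: "w = u \<otimes> (a \<otimes> b)" using a b u by (simp add: m_assoc)
  have "len (u \<otimes> (a \<otimes> b)) \<le> len u + len (a \<otimes> b)" "len (a \<otimes> b) \<le> len a + len b"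
    using a b u by (intro len_mult; simp)+
  then show ?thesis
    unfolding w using a b u w by (subst pre_mult_iff) auto
qed

lemma pre_reduced:
  assumes "reduced (us @ vs)"
  shows "pre (pr us) (pr (us @ vs))"
  using reduced_appendD[OF assms] pr_append'[OF assms] by (simp add: pre_mult_iff)

lemma pre_descent_iff:
  assumes "s \<in> S" "w \<in> carrier W"
  shows "pre s w \<longleftrightarrow> len (s \<otimes> w) < len w"
proof -
  show ?thesis
    using len_Cons[OF assms] assms S_carrier len_S by (auto simp: pre_def S_inv)
qed

lemma pre_step:
  assumes "pre u w" "u \<noteq> w"
  shows "\<exists>s\<in>S. len (u \<otimes> s) = Suc (len u) \<and> pre (u \<otimes> s) w"
proof -
  from assms(1) obtain v where v: "v \<in> carrier W" "w = u \<otimes> v" "len (u \<otimes> v) = len u + len v"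
    by (rule preE)
  have u: "u \<in> carrier W" using assms pre_carrier by blast
  have "v \<noteq> \<one>" using v u assms by auto
  then have "rw v \<noteq> []" using rw(2)[OF v(1)] by auto
  then obtain s ws where ws: "rw v = [s] @ ws" by (metis append_Cons append_Nil list.exhaust)
  have s: "s \<in> S" using rw(3)[OF v(1)] ws by simp
  have "pre (pr [s]) v" using pre_reduced[of "[s]" ws] rw[OF v(1)] ws by simp
  then have "pre s v" using s S_carrier by simp
  then show ?thesis
    using pre_mult_left[OF u, of s v] v s len_S by (intro bexI[of _ s]) auto
qed

text \<open>Newman's lemma for the covering relation: by \<open>dihedral_prefix\<close> any two covers of a common
  lower bound \<open>u\<close> have an upper bound among the common lower bounds.\<close>

lemma meet_exists:
  assumes "a \<in> carrier W" "b \<in> carrier W"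
  shows "\<exists>m. pre m a \<and> pre m b \<and> (\<forall>u. pre u a \<and> pre u b \<longrightarrow> pre u m)"
proof -
  \<comment> \<open>\<open>E\<close> holds of the common lower bounds of \<open>a\<close> and
    \<open>b\<close>, \<open>Mx\<close> of the maximal ones. The meet exists once there is only one
    maximal element.\<close>
  define E where "E u \<longleftrightarrow> pre u a \<and> pre u b" for u
  define Mx where "Mx p \<longleftrightarrow> E p \<and> (\<forall>v. E v \<and> pre p v \<longrightarrow> v = p)" for p
  have E_down: "E u" if "pre u v" "E v" for u v
    using that pre_trans unfolding E_def by blast
  have ex_max: "\<exists>p. Mx p \<and> pre u p" if "E u" for u
    using that
  proof (induction "len a - len u" arbitrary: u rule: less_induct)
    case less
    show ?case
    proof (cases "Mx u")
      case True
      then show ?thesis using less.prems pre_carrier by (auto simp: E_def intro: pre_refl)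
    next
      case False
      then obtain v where v: "E v" "pre u v" "v \<noteq> u" using less.prems by (auto simp: Mx_def)
      have "len u < len v" using pre_len_eq[OF v(2)] v(3) by force
      moreover have "len v \<le> len a" using v(1) pre_len by (auto simp: E_def)
      ultimately obtain p where "Mx p" "pre v p" using less.hyps[of v] v diff_less_mono2 by fastforce
      then show ?thesis using v pre_trans by blast
    qed
  qed
  \<comment> \<open>After stripping \<open>u\<close> from \<open>x\<close>, both letters are left
    descents of the quotient \<open>z\<close>, so the full alternating product is a prefix of
    \<open>z\<close>.\<close>
  have dihedral: "pre (u \<otimes> pr (alternating s t (cox_ord s t))) x"
      "len (u \<otimes> pr (alternating s t (cox_ord s t))) = len u + len (pr (alternating s t (cox_ord s t)))"
    if st: "s \<in> S" "t \<in> S" "s \<noteq> t" and "pre u x" and l: "len (u \<otimes> s) = Suc (len u)"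
      "len (u \<otimes> t) = Suc (len u)" and p: "pre (u \<otimes> s) x" "pre (u \<otimes> t) x" for u s t x
  proof -
    from \<open>pre u x\<close> obtain z where z: "z \<in> carrier W" "x = u \<otimes> z" "len (u \<otimes> z) = len u + len z"
      by (rule preE)
    have u: "u \<in> carrier W" using \<open>pre u x\<close> pre_carrier by blast
    have "pre s z" "pre t z"
      using pre_mult_leftD[OF u _ z(1)] l p z st S_carrier len_S by auto
    then obtain zs where "reduced (alternating s t (cox_ord s t) @ zs)"
        "pr (alternating s t (cox_ord s t) @ zs) = z"
      using dihedral_prefix[OF st z(1), of "cox_ord s t"] st z(1) by (auto simp: pre_descent_iff)
    then have "pre (pr (alternating s t (cox_ord s t))) z"
      using pre_reduced by blast
    then show "pre (u \<otimes> pr (alternating s t (cox_ord s t))) x"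
      "len (u \<otimes> pr (alternating s t (cox_ord s t))) = len u + len (pr (alternating s t (cox_ord s t)))"
      using pre_mult_left[OF u] z by simp_all
  qed
  \<comment> \<open>Induction on the distance from \<open>u\<close> up to the length of
    \<open>a\<close>, moving to a cover of \<open>u\<close> in each step.\<close>
  have uniq: "p = q" if "E u" "Mx p" "Mx q" "pre u p" "pre u q" for u p q
    using that
  proof (induction "len a - len u" arbitrary: u p q rule: less_induct)
    case less
    have IH: "p' = q'" if "E v" "Mx p'" "Mx q'" "pre v p'" "pre v q'" "len v = Suc (len u)" for v p' q'
    proof -
      have "len v \<le> len a" using that(1) pre_len by (auto simp: E_def)
      then show ?thesis using less.hyps[OF _ that(1-5)] that(6) by simp
    qed
    show ?case
    proof (cases "u = p \<or> u = q")
      case True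
      then show ?thesis using less.prems by (auto simp: Mx_def)
    next
      case False
      obtain s where s: "s \<in> S" "len (u \<otimes> s) = Suc (len u)" "pre (u \<otimes> s) p"
        using pre_step[OF less.prems(4)] False by auto
      obtain t where t: "t \<in> S" "len (u \<otimes> t) = Suc (len u)" "pre (u \<otimes> t) q"
        using pre_step[OF less.prems(5)] False by auto
      have E: "E (u \<otimes> s)" "E (u \<otimes> t)"
        using E_down s t less.prems by (auto simp: Mx_def)
      show ?thesis
      proof (cases "s = t")
        case True
        then show ?thesis using IH[OF E(1) less.prems(2,3)] s t by simp
      next
        case False
        let ?d = "pr (alternating s t (cox_ord s t))"
        have d: "E (u \<otimes> ?d)"
          using dihedral(1)[OF s(1) t(1) False _ s(2) t(2)] less.prems(1) E by (simp add: E_def)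
        \<comment> \<open>\<open>r\<close> is maximal above both covers: the induction hypothesis at
          \<open>u s\<close> gives \<open>p = r\<close>, and at \<open>u t\<close> it gives
          \<open>q = r\<close>.\<close>
        then obtain r where r: "Mx r" "pre (u \<otimes> ?d) r" using ex_max by blast
        have u: "u \<in> carrier W" using less.prems pre_carrier by (auto simp: E_def)
        have dd: "?d = pr (alternating t s (cox_ord s t))"
          using pr_alternating_eq_iff[OF s(1) t(1), of "cox_ord s t"] by simp
        obtain m where m: "cox_ord s t = Suc m"
          using cox_ord_pos[OF s(1) t(1)] gr0_conv_Suc by auto
        have rd: "reduced (alternating s t (cox_ord s t))" "reduced (alternating t s (cox_ord s t))"
          using reduced_alternating s t False cox_ord_commute[of s t] by auto
        have sd: "pre s ?d"
          using pre_reduced[of "[s]" "alternating t s m"] rd(1) s(1) S_carrier unfolding m by simp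
        have "pre t (pr (alternating t s (cox_ord s t)))"
          using pre_reduced[of "[t]" "alternating s t m"] rd(2) t(1) S_carrier unfolding m by simp
        then have td: "pre t ?d" using dd by simp
        have "len (u \<otimes> ?d) = len u + len ?d"
          using dihedral(2)[OF s(1) t(1) False _ s(2) t(2)] less.prems(1) E by (auto simp: E_def)
        then have "pre (u \<otimes> s) (u \<otimes> ?d)" "pre (u \<otimes> t) (u \<otimes> ?d)"
          using pre_mult_left(2)[OF u sd] pre_mult_left(2)[OF u td] by simp_all
        then have "pre (u \<otimes> s) r" "pre (u \<otimes> t) r" using r pre_trans by blast+
        then have "p = r" "q = r"
          using IH[OF E(1) less.prems(2) r(1)] IH[OF E(2) less.prems(3) r(1)] s t by auto
        then show ?thesis by simp
      qed
    qed
  qed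
  \<comment> \<open>The identity lies below all maximal elements, so \<open>uniq\<close> applied
    there identifies them all.\<close>
  have one: "E \<one>" using assms by (simp add: E_def)
  then obtain m where m: "Mx m" using ex_max by blast
  have "pre u m" if "E u" for u
  proof -
    obtain p where p: "Mx p" "pre u p" using ex_max[OF \<open>E u\<close>] by blast
    then have "p = m"
      using uniq[OF one p(1) m] m pre_carrier(1)[of p a] pre_carrier(1)[of m a]
      by (auto simp: Mx_def E_def)
    then show ?thesis using p by simp
  qed
  then show ?thesis using m unfolding Mx_def E_def by blast
qed

text \<open>Every letter shortens \<open>w\<close> from the left, since it cannot lengthen it. Hence
  \<open>exchange_append\<close> puts any reduced word in front of a reduced word for
  \<open>w\<close>, letter by letter.\<close>

lemma pre_maximal_length:
  assumes "w \<in> carrier W" "\<And>v. v \<in> carrier W \<Longrightarrow> len v \<le> len w" "v \<in> carrier W"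
  shows "pre v w"
proof -
  have "\<exists>zs. reduced (vs @ zs) \<and> pr (vs @ zs) = w" if "reduced vs" for vs
    using that
  proof (induction vs)
    case Nil
    then show ?case using rw[OF assms(1)] by auto
  next
    case (Cons s vs)
    then have s: "s \<in> S" and "reduced vs"
      using reduced_appendD(2)[of "[s]" vs] by (auto simp: reduced_def)
    with Cons.IH obtain zs where zs: "reduced (vs @ zs)" "pr (vs @ zs) = w" by blast
    have "len (s \<otimes> w) < len w"
      using len_Cons[OF s assms(1)] assms(2)[of "s \<otimes> w"] assms(1) s S_carrier by auto
    then show ?case using exchange_append[OF zs(1) Cons.prems] zs(2) by auto
  qed
  from this[of "rw v"] show ?thesis
    using rw[OF assms(3)] pre_reduced by metis
qed

section \<open>The longest element\<close>

abbreviation w0 :: 'a where "w0 \<equiv> longest_element W S"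

lemma w0_longest: "w0 \<in> carrier W" "v \<in> carrier W \<Longrightarrow> len v \<le> len w0"
proof -
  have "\<exists>!w. w \<in> carrier W \<and> (\<forall>v\<in>carrier W. len v \<le> len w)"
  proof (rule ex_ex1I)
    have "Max (len ` carrier W) \<in> len ` carrier W"
      using fin by (intro Max_in) auto
    then obtain w where "w \<in> carrier W" "len w = Max (len ` carrier W)" by auto
    then show "\<exists>w. w \<in> carrier W \<and> (\<forall>v\<in>carrier W. len v \<le> len w)"
      using fin by auto
  next
    fix w w' assume "w \<in> carrier W \<and> (\<forall>v\<in>carrier W. len v \<le> len w)"
      "w' \<in> carrier W \<and> (\<forall>v\<in>carrier W. len v \<le> len w')"
    then show "w = w'"
      using pre_len_eq[OF pre_maximal_length[of w' w]] by auto
  qed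
  from theI'[OF this, folded longest_element_def]
  show "w0 \<in> carrier W" "v \<in> carrier W \<Longrightarrow> len v \<le> len w0" by auto
qed

lemma pre_w0: "v \<in> carrier W \<Longrightarrow> pre v w0"
  using pre_maximal_length w0_longest by blast

lemma len_w0: "v \<in> carrier W \<Longrightarrow> len v + len (inv v \<otimes> w0) = len w0"
  using pre_w0 by (simp add: pre_def)

lemma w0_inv: "inv w0 = w0"
  using pre_len_eq[OF pre_w0[of "inv w0"]] w0_longest by simp

lemma w0_square: "w0 \<otimes> w0 = \<one>"
  using w0_inv w0_longest r_inv by metis

subsection \<open>Normal forms and cancellation\<close>

lemma pre_antisym: "pre u v \<Longrightarrow> pre v u \<Longrightarrow> u = v"
  using pre_len pre_len_eq by blast

text \<open>Passing to the complement \<open>inv x \<otimes> w0\<close> subtracts lengths from that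
  of \<open>w0\<close>. This turns additivity into a lower-bound condition in the weak order, so the
  largest admissible \<open>u\<close> is a meet.\<close>

lemma len_mult_iff_pre:
  assumes "x \<in> carrier W" "u \<in> carrier W"
  shows "len (x \<otimes> u) = len x + len u \<longleftrightarrow> pre u (inv x \<otimes> w0)"
proof -
  have "inv (x \<otimes> u) \<otimes> w0 = inv u \<otimes> (inv x \<otimes> w0)"
    using assms w0_longest by (simp add: inv_mult_group m_assoc)
  then show ?thesis
    using len_w0[of x] len_w0[of "x \<otimes> u"] assms w0_longest by (auto simp: pre_def)
qed

lemma len_mult_left:
  assumes "x \<in> carrier W" "y \<in> carrier W" "z \<in> carrier W"
    "len (x \<otimes> (y \<otimes> z)) = len x + len y + len z"
  shows "len (y \<otimes> z) = len y + len z"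
  using len_mult[of y z] len_mult[of x "y \<otimes> z"] assms by simp

text \<open>The meet of \<open>w\<close> with the complement of \<open>x\<close>; by
  \<open>len_mult_iff_pre\<close> it is the largest prefix \<open>h\<close> of \<open>w\<close> for
  which \<open>x h\<close> is length-additive.\<close>

definition head :: "'a \<Rightarrow> 'a \<Rightarrow> 'a" where
  "head x w = (SOME m. pre m w \<and> pre m (inv x \<otimes> w0) \<and>
     (\<forall>u. pre u w \<and> pre u (inv x \<otimes> w0) \<longrightarrow> pre u m))"

lemma head:
  assumes "x \<in> carrier W" "w \<in> carrier W"
  shows "pre (head x w) w" "head x w \<in> carrier W" "len (x \<otimes> head x w) = len x + len (head x w)"
    "pre u w \<Longrightarrow> len (x \<otimes> u) = len x + len u \<Longrightarrow> pre u (head x w)"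
proof -
  have "inv x \<otimes> w0 \<in> carrier W" using assms w0_longest by simp
  from someI_ex[OF meet_exists[OF assms(2) this], folded head_def]
  have *: "pre (head x w) w" "pre (head x w) (inv x \<otimes> w0)"
    "\<And>u. pre u w \<Longrightarrow> pre u (inv x \<otimes> w0) \<Longrightarrow> pre u (head x w)" by auto
  show "pre (head x w) w" by fact
  then show c: "head x w \<in> carrier W" by (rule pre_carrier)
  show "len (x \<otimes> head x w) = len x + len (head x w)"
    using *(2) c assms by (simp add: len_mult_iff_pre)
  show "pre u (head x w)" if "pre u w" "len (x \<otimes> u) = len x + len u"
    using * that pre_carrier(1)[OF that(1)] assms by (simp add: len_mult_iff_pre)
qed

lemma head_one: "w \<in> carrier W \<Longrightarrow> head \<one> w = w"
  using head[of \<one> w] pre_antisym pre_refl by simp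

text \<open>Acting by \<open>y\<close> and then by \<open>x\<close> selects the same prefix of
  \<open>w\<close> as acting by the product. The new head has \<open>y\<close> as a prefix, because
  \<open>y\<close> itself is admissible; what remains after \<open>y\<close> is a prefix of
  \<open>w\<close> that is additive with \<open>x y\<close>.\<close>

lemma head_mult:
  assumes x: "x \<in> carrier W" and y: "y \<in> carrier W" and w: "w \<in> carrier W"
    and xy: "len (x \<otimes> y) = len x + len y"
  shows "head x (y \<otimes> head y w) = y \<otimes> head (x \<otimes> y) w" "pre (head (x \<otimes> y) w) (head y w)"
proof -
  let ?h = "head y w" and ?k = "head (x \<otimes> y) w"
  have h: "?h \<in> carrier W" "len (y \<otimes> ?h) = len y + len ?h" using head y w by auto
  have k: "?k \<in> carrier W" "pre ?k w" "len (x \<otimes> (y \<otimes> ?k)) = len x + len y + len ?k"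
    using head[of "x \<otimes> y" w] x y w xy by (auto simp: m_assoc)
  have yk: "len (y \<otimes> ?k) = len y + len ?k" by (rule len_mult_left[OF x y k(1,3)])
  then show kh: "pre ?k ?h" using head(4)[OF y w] k by blast
  let ?v = "head x (y \<otimes> ?h)"
  have v: "pre ?v (y \<otimes> ?h)" "?v \<in> carrier W" "len (x \<otimes> ?v) = len x + len ?v"
    "\<And>u. pre u (y \<otimes> ?h) \<Longrightarrow> len (x \<otimes> u) = len x + len u \<Longrightarrow> pre u ?v"
    using head[of x "y \<otimes> ?h"] x y h by auto
  have "pre (y \<otimes> ?k) ?v"
    using v(4) pre_mult_left(2)[OF y kh h(2)] k yk by simp
  moreover have "pre ?v (y \<otimes> ?k)"
  proof -
    have "pre y ?v" using v(4) xy y h pre_mult_iff by simp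
    then obtain u where u: "u \<in> carrier W" "?v = y \<otimes> u" "len (y \<otimes> u) = len y + len u"
      by (rule preE)
    have "pre u ?h" using pre_mult_leftD[OF y u(1) h(1)] v(1) u h by simp
    then have "pre u w" using head(1)[OF y w] pre_trans by blast
    moreover have "len (x \<otimes> y \<otimes> u) = len (x \<otimes> y) + len u"
      using v(3) u x y xy by (simp add: m_assoc)
    ultimately have "pre u ?k" using head(4)[of "x \<otimes> y" w u] x y w by simp
    then show ?thesis using pre_mult_left(2)[OF y _ yk] u by simp
  qed
  ultimately show "?v = y \<otimes> ?k" by (rule pre_antisym[symmetric])
qed

lemma rw_one [simp]: "rw \<one> = []"
  using rw(4)[of \<one>] by simp

lemma rw_mult:
  assumes "x \<in> carrier W" "y \<in> carrier W" "len (x \<otimes> y) = len x + len y"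
  shows "rw (x \<otimes> y) \<simeq> rw x @ rw y"
proof (rule Matsumoto)
  show "reduced (rw (x \<otimes> y))" using rw assms by simp
  show "reduced (rw x @ rw y)" using rw[of x] rw[of y] assms by (intro reduced_appendI) auto
  show "pr (rw (x \<otimes> y)) = pr (rw x @ rw y)"
    using rw[of x] rw[of y] rw[of "x \<otimes> y"] assms by (simp add: pr_append)
qed

lemma rw_pre: "pre u w \<Longrightarrow> rw w \<simeq> rw u @ rw (inv u \<otimes> w)"
  using rw_mult[of u "inv u \<otimes> w"] by (auto simp: pre_def)

lemma rw_pr: "reduced ws \<Longrightarrow> rw (pr ws) \<simeq> ws"
  using Matsumoto[of "rw (pr ws)" ws] rw[of "pr ws"] by simp

lemma rw_Cons:
  assumes "s \<in> S" "w \<in> carrier W" "len (s \<otimes> w) = Suc (len w)"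
  shows "rw (s \<otimes> w) \<simeq> s # rw w"
proof -
  have "reduced (s # rw w)"
    using rw[OF assms(2)] assms by (intro reducedI) auto
  from rw_pr[OF this] rw[OF assms(2)] show ?thesis by simp
qed

text \<open>A pair \<open>(w, n)\<close> stands for the positive braid \<open>w\<close> times \<open>n\<close>. Letters act by left
  multiplication, after which the simple part is again chosen as large as possible.\<close>

definition act1 :: "'a \<Rightarrow> 'a \<times> 'a list \<Rightarrow> 'a \<times> 'a list" where
  "act1 s p = (s \<otimes> head s (fst p), rw (inv (head s (fst p)) \<otimes> fst p) @ snd p)"

definition act :: "'a list \<Rightarrow> 'a \<times> 'a list \<Rightarrow> 'a \<times> 'a list" where
  "act ws = foldr act1 ws"

lemma act_simps [simp]: "act [] p = p" "act (s # ws) p = act1 s (act ws p)"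
  by (simp_all add: act_def)

lemma act_append: "act (us @ vs) p = act us (act vs p)"
  by (simp add: act_def)

text \<open>The second components are compared only up to braid moves because \<open>rw\<close>
  picks arbitrary reduced words, which need not concatenate to one another.\<close>

definition sim :: "'a \<times> 'a list \<Rightarrow> 'a \<times> 'a list \<Rightarrow> bool" where
  "sim p q \<longleftrightarrow> fst p = fst q \<and> snd p \<simeq> snd q"

lemma act_sim: "sim p q \<Longrightarrow> sim (act ws p) (act ws q)"
  by (induction ws) (auto simp: sim_def act1_def intro: braid_cong_append)

lemma act_carrier: "set ws \<subseteq> S \<Longrightarrow> fst p \<in> carrier W \<Longrightarrow> fst (act ws p) \<in> carrier W"
  by (induction ws) (auto simp: act1_def S_carrier head)

text \<open>By \<open>head_mult\<close> the successive heads collapse into a single one, so up to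
  \<open>sim\<close> a reduced word acts only through its product in \<open>W\<close>. This makes
  the two sides of a braid relation act alike.\<close>

lemma act_reduced:
  assumes "reduced xs" "w \<in> carrier W"
  shows "sim (act xs (w, n)) (pr xs \<otimes> head (pr xs) w, rw (inv (head (pr xs) w) \<otimes> w) @ n)"
  using assms(1)
proof (induction xs)
  case Nil
  then show ?case using assms by (simp add: sim_def head_one)
next
  case (Cons s xs)
  let ?x = "pr xs"
  let ?h = "head ?x w" and ?k = "head (s \<otimes> ?x) w"
  have s: "s \<in> S" "s \<in> carrier W" and xs: "reduced xs"
    using Cons.prems reduced_appendD(2)[of "[s]" xs] S_carrier by (auto simp: reduced_def)
  have x: "?x \<in> carrier W" "len (s \<otimes> ?x) = len s + len ?x"
    using xs s Cons.prems len_S by (auto simp: reduced_def)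
  have hd: "head s (?x \<otimes> ?h) = ?x \<otimes> ?k" and kh: "pre ?k ?h"
    using head_mult[OF s(2) x(1) assms(2) x(2)] by auto
  have h: "?h \<in> carrier W" "pre ?h w" using head[OF x(1) assms(2)] by auto
  have k: "?k \<in> carrier W" "pre ?k w"
    using head[of "s \<otimes> ?x" w] x s assms(2) by auto
  have "inv (?x \<otimes> ?k) \<otimes> (?x \<otimes> ?h) = inv ?k \<otimes> ?h"
    using x k h by (simp add: inv_mult_group m_assoc)
  then have "sim (act (s # xs) (w, n))
      (s \<otimes> (?x \<otimes> ?k), rw (inv ?k \<otimes> ?h) @ rw (inv ?h \<otimes> w) @ n)"
    using Cons.IH[OF xs] hd by (auto simp: sim_def act1_def intro: braid_cong_append)
  \<comment> \<open>The remainders split off by \<open>s\<close> and by \<open>xs\<close> multiply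
    length-additively to the remainder of the combined step.\<close>
  moreover have "rw (inv ?k \<otimes> ?h) @ rw (inv ?h \<otimes> w) \<simeq> rw (inv ?k \<otimes> w)"
  proof -
    have eq: "(inv ?k \<otimes> ?h) \<otimes> (inv ?h \<otimes> w) = inv ?k \<otimes> w"
      using k h assms(2) by (simp add: m_assoc)
    have "len (inv ?k \<otimes> w) = len (inv ?k \<otimes> ?h) + len (inv ?h \<otimes> w)"
      using kh k h by (simp add: pre_def)
    then show ?thesis
      using rw_mult[of "inv ?k \<otimes> ?h" "inv ?h \<otimes> w"] eq k h assms(2) by (simp add: braid_cong.sym)
  qed
  then have "rw (inv ?k \<otimes> ?h) @ rw (inv ?h \<otimes> w) @ n \<simeq> rw (inv ?k \<otimes> w) @ n"
    using braid_cong_append[OF _ braid_cong.refl, of _ _ n] by fastforce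
  ultimately show ?case
    using s x k by (auto simp: sim_def m_assoc intro: braid_cong.trans)
qed

lemma sim_sym: "sim p q \<Longrightarrow> sim q p"
  by (auto simp: sim_def intro: braid_cong.sym)

lemma sim_trans: "sim p q \<Longrightarrow> sim q r \<Longrightarrow> sim p r"
  by (auto simp: sim_def intro: braid_cong.trans)

lemma act_braid_cong:
  "us \<simeq> vs \<Longrightarrow> us \<in> lists S \<Longrightarrow> fst p \<in> carrier W \<Longrightarrow> sim (act us p) (act vs p)"
proof (induction arbitrary: p rule: braid_cong.induct)
  case (braid s t us vs)
  let ?m = "cox_ord s t"
  have "fst (act vs p) \<in> carrier W"
    using braid by (intro act_carrier) auto
  moreover have "reduced (alternating s t ?m)" "reduced (alternating t s ?m)"
    using reduced_alternating braid cox_ord_commute[of s t] by auto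
  moreover have "pr (alternating s t ?m) = pr (alternating t s ?m)"
    using pr_alternating_eq_iff[of s t ?m] braid by simp
  ultimately have "sim (act (alternating s t ?m) (act vs p)) (act (alternating t s ?m) (act vs p))"
    using act_reduced[of "alternating s t ?m" "fst (act vs p)" "snd (act vs p)"]
      act_reduced[of "alternating t s ?m" "fst (act vs p)" "snd (act vs p)"]
    by (auto intro: sim_trans sim_sym)
  then show ?case by (simp add: act_append act_sim)
next
  case (sym us vs)
  then show ?case using braid_cong_lists sim_sym by blast
next
  case (trans us vs ws)
  then show ?case using braid_cong_lists sim_trans by blast
qed (simp add: sim_def)

text \<open>Acting by \<open>ws\<close> really multiplies the represented braid by
  \<open>ws\<close>: each letter only splits the simple part at its head and merges the letter into
  that head.\<close>

lemma act_braid: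
  assumes "ws \<in> lists S" "fst p \<in> carrier W" "snd p \<in> lists S"
  shows "snd (act ws p) \<in> lists S" "ws @ rw (fst p) @ snd p \<simeq> rw (fst (act ws p)) @ snd (act ws p)"
proof -
  have "snd (act ws p) \<in> lists S \<and>
    ws @ rw (fst p) @ snd p \<simeq> rw (fst (act ws p)) @ snd (act ws p)"
    using assms(1)
  proof (induction ws)
    case Nil
    then show ?case using assms by simp
  next
    case (Cons s ws)
    define w n where "w = fst (act ws p)" and "n = snd (act ws p)"
    have s: "s \<in> S" "s \<in> carrier W" and IH: "n \<in> lists S" "ws @ rw (fst p) @ snd p \<simeq> rw w @ n"
      using Cons S_carrier by (auto simp: w_def n_def)
    have w: "w \<in> carrier W" using Cons.hyps assms act_carrier unfolding w_def by blast
    note h = head[OF s(2) w]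
    have "s # ws @ rw (fst p) @ snd p \<simeq> s # rw w @ n"
      using braid_cong_Cons[OF IH(2)] by simp
    also have "s # rw w @ n \<simeq> s # (rw (head s w) @ rw (inv (head s w) \<otimes> w)) @ n"
      using rw_pre[OF h(1)] by (intro braid_cong_Cons braid_cong_append) auto
    also have "s # (rw (head s w) @ rw (inv (head s w) \<otimes> w)) @ n
        \<simeq> rw (s \<otimes> head s w) @ rw (inv (head s w) \<otimes> w) @ n"
      using braid_cong_append[OF braid_cong.sym[OF rw_Cons[OF s(1) h(2)]] braid_cong.refl]
        h(3) len_S[OF s(1)] by simp
    finally show ?case
      using IH(1) rw(3)[of "inv (head s w) \<otimes> w"] w h(2)
      by (simp add: act1_def w_def n_def)
  qed
  then show "snd (act ws p) \<in> lists S"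
    "ws @ rw (fst p) @ snd p \<simeq> rw (fst (act ws p)) @ snd (act ws p)" by auto
qed

section \<open>The largest simple divisor and left cancellation\<close>

definition alpha :: "'a list \<Rightarrow> 'a" where "alpha ws = fst (act ws (\<one>, []))"
definition omega :: "'a list \<Rightarrow> 'a list" where "omega ws = snd (act ws (\<one>, []))"

lemma alpha_omega:
  assumes "ws \<in> lists S"
  shows "alpha ws \<in> carrier W" "omega ws \<in> lists S" "ws \<simeq> rw (alpha ws) @ omega ws"
  using act_braid[OF assms, of "(\<one>, [])"] act_carrier[of ws "(\<one>, [])"] assms
  by (auto simp: alpha_def omega_def)

lemma alpha_omega_cong:
  assumes "us \<simeq> vs" "us \<in> lists S"
  shows "alpha us = alpha vs" "omega us \<simeq> omega vs"
  using act_braid_cong[OF assms, of "(\<one>, [])"] by (auto simp: sim_def alpha_def omega_def)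

text \<open>The normal form of \<open>s # xs\<close> determines \<open>xs\<close>: its simple part
  is \<open>s h\<close>, which yields \<open>h\<close>, and its second part is the remainder of
  \<open>alpha xs\<close> followed by \<open>omega xs\<close>. Putting \<open>h\<close> back in
  front recovers \<open>xs\<close>.\<close>

lemma left_cancel_Cons:
  assumes "s # xs \<simeq> s # ys" "s # xs \<in> lists S"
  shows "xs \<simeq> ys"
proof -
  have s: "s \<in> S" "s \<in> carrier W" and l: "xs \<in> lists S" "ys \<in> lists S"
    using assms braid_cong_lists[OF assms(1)] S_carrier by auto
  let ?h = "head s (alpha xs)" and ?k = "head s (alpha ys)"
  have h: "pre ?h (alpha xs)" "?h \<in> carrier W" using head[OF s(2) alpha_omega(1)[OF l(1)]] by auto
  have k: "pre ?k (alpha ys)" "?k \<in> carrier W" using head[OF s(2) alpha_omega(1)[OF l(2)]] by auto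
  have "s \<otimes> ?h = s \<otimes> ?k" and
    om: "rw (inv ?h \<otimes> alpha xs) @ omega xs \<simeq> rw (inv ?k \<otimes> alpha ys) @ omega ys"
    using alpha_omega_cong[OF assms] by (simp_all add: alpha_def omega_def act1_def)
  then have hk: "?k = ?h" using s h k by simp
  have "xs \<simeq> (rw ?h @ rw (inv ?h \<otimes> alpha xs)) @ omega xs"
    using alpha_omega(3)[OF l(1)] braid_cong_append[OF rw_pre[OF h(1)] braid_cong.refl]
      braid_cong.trans by blast
  also have "\<dots> \<simeq> (rw ?k @ rw (inv ?k \<otimes> alpha ys)) @ omega ys"
    using om hk braid_cong_append[OF braid_cong.refl om] by simp
  also have "\<dots> \<simeq> ys"
    using alpha_omega(3)[OF l(2)] braid_cong_append[OF rw_pre[OF k(1)] braid_cong.refl]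
      braid_cong.trans braid_cong.sym by blast
  finally show ?thesis .
qed

lemma left_cancel: "ps @ xs \<simeq> ps @ ys \<Longrightarrow> ps @ xs \<in> lists S \<Longrightarrow> xs \<simeq> ys"
proof (induction ps)
  case (Cons s ps)
  then show ?case using left_cancel_Cons[of s "ps @ xs" "ps @ ys"] by simp
qed simp

subsection \<open>Divisors of products of two simple braids\<close>

lemma pre_alpha:
  assumes "reduced xs" "xs @ ws \<in> lists S"
  shows "pre (pr xs) (alpha (xs @ ws))"
proof -
  have x: "pr xs \<in> carrier W" using assms by simp
  let ?a = "fst (act ws (\<one>, []))"
  have a: "?a \<in> carrier W" using assms by (intro act_carrier) auto
  have "alpha (xs @ ws) = pr xs \<otimes> head (pr xs) ?a"
    using act_reduced[OF assms(1) a, of "snd (act ws (\<one>, []))"]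
    by (simp add: alpha_def act_append sim_def)
  then show ?thesis using head[OF x a] x by (simp add: pre_mult_iff)
qed

text \<open>The first claim is maximality of \<open>alpha\<close>. Splitting \<open>alpha m\<close>
  at \<open>pr xs\<close> then puts \<open>xs\<close> in front of the normal form of
  \<open>m\<close>, where it can be cancelled.\<close>

lemma simple_divisor:
  assumes "reduced xs" "m \<simeq> xs @ ws" "m \<in> lists S"
  shows "pre (pr xs) (alpha m)" "ws \<simeq> rw (inv (pr xs) \<otimes> alpha m) @ omega m"
proof -
  have l: "xs @ ws \<in> lists S" using assms braid_cong_lists by blast
  have x: "pr xs \<in> carrier W" using assms by simp
  show p: "pre (pr xs) (alpha m)"
    using pre_alpha[OF assms(1) l] alpha_omega_cong[OF assms(2,3)] by simp
  have "xs @ ws \<simeq> m" using assms(2) by (rule braid_cong.sym)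
  also have "m \<simeq> rw (alpha m) @ omega m" by (rule alpha_omega(3)[OF assms(3)])
  also have "\<dots> \<simeq> (xs @ rw (inv (pr xs) \<otimes> alpha m)) @ omega m"
    using braid_cong.trans[OF rw_pre[OF p] braid_cong_append[OF rw_pr[OF assms(1)] braid_cong.refl]]
    by (intro braid_cong_append) auto
  finally show "ws \<simeq> rw (inv (pr xs) \<otimes> alpha m) @ omega m"
    using left_cancel l by simp
qed

text \<open>Removing \<open>xs\<close> from the normal form of \<open>s # c\<close> leaves the
  reduced word \<open>ys\<close>, so its suffix \<open>omega (s # c)\<close> is reduced. Removing
  \<open>s\<close> instead leaves a simple braid followed by that same
  \<open>omega (s # c)\<close>.\<close>

lemma simple_pair_tail:
  assumes "s # c \<simeq> xs @ ys" "s # c \<in> lists S" "reduced xs" "reduced ys"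
  shows "\<exists>xs' ys'. reduced xs' \<and> reduced ys' \<and> c \<simeq> xs' @ ys'"
proof -
  have s: "s \<in> S" using assms by simp
  have c: "c \<simeq> rw (inv (pr [s]) \<otimes> alpha (s # c)) @ omega (s # c)"
    using simple_divisor(2)[OF reduced_singleton[OF s], of "s # c" c] assms by simp
  have "reduced (rw (inv (pr xs) \<otimes> alpha (s # c)) @ omega (s # c))"
    using simple_divisor(2)[OF assms(3,1,2)] assms(4) braid_cong_reduced by blast
  then have "reduced (omega (s # c))" by (rule reduced_appendD)
  moreover have "inv (pr [s]) \<otimes> alpha (s # c) \<in> carrier W"
    using s S_carrier alpha_omega(1)[OF assms(2)] by simp
  ultimately show ?thesis using c rw(1) by blast
qed

lemma simple_pair_suffix:
  assumes "as @ bs \<simeq> xs @ ys" "as @ bs \<in> lists S" "reduced xs" "reduced ys"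
  shows "\<exists>xs' ys'. reduced xs' \<and> reduced ys' \<and> bs \<simeq> xs' @ ys'"
  using assms
proof (induction as arbitrary: xs ys)
  case (Cons s as)
  then obtain xs' ys' where "reduced xs'" "reduced ys'" "as @ bs \<simeq> xs' @ ys'"
    using simple_pair_tail[of s "as @ bs" xs ys] by auto
  then show ?case using Cons.IH[of xs' ys'] Cons.prems(2) by simp
qed auto

subsection \<open>The Garside element\<close>

abbreviation D :: "'a list" where "D \<equiv> rw w0"

lemma D_reduced: "reduced D" "pr D = w0" "D \<in> lists S"
  using rw w0_longest by auto

lemma D_prefix:
  assumes "reduced us"
  shows "\<exists>vs. reduced vs \<and> D \<simeq> us @ vs"
proof -
  have p: "pre (pr us) w0" using pre_w0 assms by simp
  have "D \<simeq> us @ rw (inv (pr us) \<otimes> w0)"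
    using rw_pre[OF p] rw_pr[OF assms] braid_cong_append[OF _ braid_cong.refl] braid_cong.trans by blast
  then show ?thesis using rw(1)[of "inv (pr us) \<otimes> w0"] w0_longest assms by auto
qed

lemma D_suffix:
  assumes "reduced us"
  shows "\<exists>vs. reduced vs \<and> D \<simeq> vs @ us"
proof -
  let ?u = "pr us"
  have u: "?u \<in> carrier W" "?u \<otimes> w0 \<in> carrier W" using assms w0_longest by auto
  \<comment> \<open>The left complement of \<open>?u\<close> in \<open>w0\<close> is a prefix of
    \<open>w0\<close> with cofactor \<open>?u\<close>.\<close>
  have "inv (w0 \<otimes> inv ?u) \<otimes> w0 = ?u" using u w0_longest by (simp add: inv_mult_group m_assoc)
  then have "rw w0 \<simeq> rw (w0 \<otimes> inv ?u) @ rw ?u"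
    using rw_pre[OF pre_w0[of "w0 \<otimes> inv ?u"]] u w0_longest by simp
  also have "\<dots> \<simeq> rw (w0 \<otimes> inv ?u) @ us"
    using rw_pr[OF assms] by (intro braid_cong_append) auto
  finally show ?thesis using rw(1)[of "w0 \<otimes> inv ?u"] u w0_longest by auto
qed

lemma D_Cons:
  assumes "s \<in> S"
  shows "s # rw (s \<otimes> w0) \<simeq> D"
proof -
  have s: "s \<in> carrier W" "s \<otimes> w0 \<in> carrier W" using assms S_carrier w0_longest by auto
  have "len (s \<otimes> (s \<otimes> w0)) = Suc (len (s \<otimes> w0))"
    using len_w0[OF s(1)] len_S[OF assms] assms w0_longest by (simp add: S_inv)
  then show ?thesis
    using rw_Cons[OF assms s(2)] assms w0_longest by (simp add: braid_cong.sym)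
qed

text \<open>As \<open>w0\<close> is an involution, this is conjugation by \<open>w0\<close>; it maps
  \<open>S\<close> to itself and describes how letters move past \<open>D\<close>.\<close>

definition tau :: "'a \<Rightarrow> 'a" where "tau s = w0 \<otimes> s \<otimes> w0"

lemma tau_tau: "s \<in> carrier W \<Longrightarrow> tau (tau s) = s"
  using w0_longest w0_square by (simp add: tau_def m_assoc) (simp add: w0_square flip: m_assoc)

text \<open>With \<open>u = s w0\<close> there are two length-additive factorisations,
  \<open>w0 = s u\<close> and \<open>w0 = u (tau s)\<close>. Comparing lengths shows that
  \<open>tau s\<close> is a letter, and \<open>s u (tau s)\<close> can be bracketed either
  way.\<close>

lemma D_shift_letter:
  assumes "s \<in> S"
  shows "tau s \<in> S" "s # D \<simeq> D @ [tau s]"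
proof -
  have s: "s \<in> carrier W" using assms S_carrier by simp
  let ?u = "s \<otimes> w0"
  have u: "?u \<in> carrier W" "inv ?u \<otimes> w0 = tau s"
    using s w0_longest assms by (simp_all add: inv_mult_group S_inv w0_inv tau_def)
  have t: "tau s \<in> carrier W" using s w0_longest by (simp add: tau_def)
  have "len s + len ?u = len w0" "len ?u + len (tau s) = len w0"
    using len_w0[OF s] len_w0[OF u(1)] u(2) assms by (simp_all add: S_inv)
  then have "len (tau s) = 1" using len_S[OF assms] by simp
  then obtain t where t': "rw (tau s) = [t]"
    using rw(4)[OF t] by (metis One_nat_def length_0_conv length_Suc_conv)
  moreover from this have "t \<in> S" "t = tau s"
    using rw(2,3)[OF t] S_carrier by auto
  ultimately have r: "rw (tau s) = [tau s]" and "tau s \<in> S" by auto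
  then show "tau s \<in> S" by simp
  have D2: "D \<simeq> rw ?u @ [tau s]" using rw_pre[OF pre_w0[OF u(1)]] u(2) r by simp
  have "s # D \<simeq> (s # rw ?u) @ [tau s]" using braid_cong_Cons[OF D2] by simp
  also have "\<dots> \<simeq> D @ [tau s]" using D_Cons[OF assms] by (rule braid_cong_append) simp
  finally show "s # D \<simeq> D @ [tau s]" .
qed

lemma tau_lists: "ws \<in> lists S \<Longrightarrow> map tau ws \<in> lists S"
  using D_shift_letter(1) by (auto simp: in_lists_conv_set)

lemma D_shift: "ws \<in> lists S \<Longrightarrow> ws @ D \<simeq> D @ map tau ws"
proof (induction ws)
  case (Cons s ws)
  then have "s # (ws @ D) \<simeq> (s # D) @ map tau ws"
    using braid_cong_Cons by fastforce
  also have "\<dots> \<simeq> (D @ [tau s]) @ map tau ws"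
    using Cons D_shift_letter(2) by (intro braid_cong_append) auto
  finally show ?case by simp
qed simp

lemma D_shift': assumes "ws \<in> lists S" shows "D @ ws \<simeq> map tau ws @ D"
proof -
  have "map (tau \<circ> tau) ws = ws"
    using assms S_carrier tau_tau by (auto intro!: map_idI)
  then show ?thesis
    using braid_cong.sym[OF D_shift[OF tau_lists[OF assms]]] by simp
qed

lemma D_square_central:
  assumes "ws \<in> lists S"
  shows "(D @ D) @ ws \<simeq> ws @ (D @ D)"
proof -
  have "D @ (D @ ws) \<simeq> D @ map tau ws @ D"
    by (rule braid_cong_append[OF braid_cong.refl D_shift'[OF assms]])
  also have "\<dots> \<simeq> (ws @ D) @ D"
    using braid_cong.sym[OF braid_cong_append[OF D_shift[OF assms] braid_cong.refl]] by simp
  finally show ?thesis by simp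
qed

subsection \<open>The positive monoid embeds into the Artin group\<close>

sublocale B: group "artin_group W S"
  unfolding artin_group_def by (rule group_presented_group)

abbreviation B :: "'a gword set monoid" where "B \<equiv> artin_group W S"
abbreviation brel :: "('a gword \<times> 'a gword) set" where "brel \<equiv> pres_rel S (braid_rels W S)"

definition br :: "'a list \<Rightarrow> 'a gword set" where
  "br ws = list_mult B (map (artin_gen W S) ws)"

lemma pos_word_gwords: "ws \<in> lists S \<Longrightarrow> pos_word ws \<in> gwords S"
  by (auto simp: pos_word_def)

lemma artin_class_closed: "w \<in> gwords S \<Longrightarrow> brel `` {w} \<in> carrier B"
  by (auto simp: artin_group_def presented_group_def intro: quotientI)

lemma artin_gen_closed: "set (map (artin_gen W S) ws) \<subseteq> carrier B" if "ws \<in> lists S"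
  using that artin_class_closed by (auto simp: artin_gen_def pres_gen_def)

lemma br_closed [simp]: "ws \<in> lists S \<Longrightarrow> br ws \<in> carrier B"
  unfolding br_def by (intro B.list_mult_closed artin_gen_closed)

lemma br_append: "us \<in> lists S \<Longrightarrow> vs \<in> lists S \<Longrightarrow> br (us @ vs) = br us \<otimes>\<^bsub>B\<^esub> br vs"
  unfolding br_def map_append by (intro B.list_mult_append artin_gen_closed)

lemma br_pos_word: "ws \<in> lists S \<Longrightarrow> br ws = brel `` {pos_word ws}"
proof (induction ws)
  case Nil
  then show ?case by (simp add: br_def pos_word_def artin_group_def presented_group_def)
next
  case (Cons s ws)
  then have "br (s # ws) = brel `` {[(s, True)]} \<otimes>\<^bsub>B\<^esub> brel `` {pos_word ws}"
    by (simp add: br_def artin_gen_def pres_gen_def)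
  also have "\<dots> = brel `` {[(s, True)] @ pos_word ws}"
    unfolding artin_group_def using Cons pos_word_gwords by (intro mult_presented_group) auto
  finally show ?case by (simp add: pos_word_def)
qed

lemma br_eq_iff_pres_rel:
  "us \<in> lists S \<Longrightarrow> vs \<in> lists S \<Longrightarrow> br us = br vs \<longleftrightarrow> (pos_word us, pos_word vs) \<in> brel"
  by (simp add: br_pos_word eq_equiv_class_iff[OF equiv_pres_rel] pos_word_gwords)

lemma br_cong: "us \<simeq> vs \<Longrightarrow> us \<in> lists S \<Longrightarrow> br us = br vs"
proof (induction rule: braid_cong.induct)
  case (braid s t us vs)
  let ?l = "alternating s t (cox_ord s t)" and ?r = "alternating t s (cox_ord s t)"
  have "(pos_word ?l, pos_word ?r) \<in> braid_rels W S"
    using braid by (auto simp: braid_rels_def)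
  then have "(pos_word ?l, pos_word ?r) \<in> brel"
    using braid pos_word_gwords pres_rel.rel[of "[]" S "[]" "pos_word ?l" "pos_word ?r"] by simp
  then have "br ?l = br ?r" using braid by (simp add: br_eq_iff_pres_rel)
  then show ?case using braid by (simp add: br_append)
qed (auto simp: braid_cong_lists)

text \<open>An inverse letter \<open>s\<^sup>-\<^sup>1\<close> is replaced by the positive word for \<open>s\<^sup>-\<^sup>1 \<Delta>\<^sup>2\<close>; the number of
  inverse letters records the power of the central element \<open>\<Delta>\<^sup>2\<close> that was introduced.\<close>

fun clear :: "'a gword \<Rightarrow> 'a list" where
  "clear [] = []"
| "clear ((s, b) # w) = (if b then [s] else rw (s \<otimes> w0) @ D) @ clear w"

definition negs :: "'a gword \<Rightarrow> nat" where
  "negs w = length (filter (\<lambda>(s, b). \<not> b) w)"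

definition Zpow :: "nat \<Rightarrow> 'a list" where
  "Zpow n = concat (replicate n (D @ D))"

lemma clear_append: "clear (u @ v) = clear u @ clear v"
  by (induction u rule: clear.induct) auto

lemma clear_lists: "w \<in> gwords S \<Longrightarrow> clear w \<in> lists S"
proof (induction w rule: clear.induct)
  case (2 s b w)
  then have "rw (s \<otimes> w0) \<in> lists S" using rw(3)[of "s \<otimes> w0"] S_carrier w0_longest by simp
  then show ?case using 2 D_reduced(3) by simp
qed simp

lemma negs_append: "negs (u @ v) = negs u + negs v"
  by (simp add: negs_def)

lemma clear_pos_word [simp]: "clear (pos_word ws) = ws" "negs (pos_word ws) = 0"
  by (induction ws) (auto simp: pos_word_def negs_def)

lemma Zpow_add: "Zpow (m + n) = Zpow m @ Zpow n"
  by (simp add: Zpow_def replicate_add)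

lemma Zpow_simps: "Zpow 0 = []" "Zpow (Suc 0) = D @ D"
  by (simp_all add: Zpow_def)

lemma Zpow_lists: "Zpow n \<in> lists S"
  using D_reduced(3) by (induction n) (auto simp: Zpow_def)

lemma Zpow_central: "ws \<in> lists S \<Longrightarrow> Zpow n @ ws \<simeq> ws @ Zpow n"
proof (induction n)
  case (Suc n)
  have "(D @ D) @ (Zpow n @ ws) \<simeq> (D @ D) @ (ws @ Zpow n)"
    by (rule braid_cong_append[OF braid_cong.refl Suc.IH[OF Suc.prems]])
  also have "\<dots> \<simeq> (ws @ D @ D) @ Zpow n"
    using braid_cong_append[OF D_square_central[OF Suc.prems] braid_cong.refl, of "Zpow n"] by simp
  finally show ?case by (simp add: Zpow_def)
qed (simp add: Zpow_def)

lemma clear_cancel: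
  assumes "a \<in> S"
  shows "clear [(a, b), (a, \<not> b)] \<simeq> D @ D"
proof (cases b)
  case True
  then show ?thesis
    using braid_cong_append[OF D_Cons[OF assms] braid_cong.refl, of D] by simp
next
  case False
  have l: "rw (a \<otimes> w0) \<in> lists S" using rw(3)[of "a \<otimes> w0"] assms S_carrier w0_longest by simp
  \<comment> \<open>Here the inverse letter comes first. An auxiliary \<open>a\<close> in front
    completes \<open>D\<close>, centrality moves the last letter to the front, and the auxiliary
    \<open>a\<close> is cancelled.\<close>
  have "a # rw (a \<otimes> w0) @ D @ [a] \<simeq> (D @ D) @ [a]"
    using braid_cong_append[OF D_Cons[OF assms] braid_cong.refl, of "D @ [a]"] by simp
  also have "\<dots> \<simeq> a # D @ D"
    using D_square_central[of "[a]"] assms by simp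
  finally have "rw (a \<otimes> w0) @ D @ [a] \<simeq> D @ D"
    by (rule left_cancel_Cons) (use assms l D_reduced(3) in simp)
  then show ?thesis using False by simp
qed

text \<open>The word \<open>u\<close> stands for the fraction \<open>clear u\<close> over
  \<open>Zpow (negs u)\<close>, and related words give equal fractions after cross-multiplication.
  Transitivity cancels the middle denominator, using its centrality and left cancellation.\<close>

lemma clear_pres_rel:
  "(u, v) \<in> brel \<Longrightarrow> clear u @ Zpow (negs v) \<simeq> clear v @ Zpow (negs u)"
proof (induction rule: pres_rel.induct)
  case (sym u v)
  show ?case by (rule braid_cong.sym[OF sym.IH])
next
  case (trans u v w)
  have l: "clear u \<in> lists S" "clear v \<in> lists S" "clear w \<in> lists S"
    using pres_rel_gwords[OF trans.hyps(1)] pres_rel_gwords[OF trans.hyps(2)]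
    by (simp_all add: clear_lists)
  let ?u = "negs u" and ?v = "negs v" and ?w = "negs w"
  have swap: "Zpow m @ Zpow n = Zpow n @ Zpow m" for m n
    by (simp add: add.commute flip: Zpow_add)
  have "Zpow ?v @ clear u @ Zpow ?w \<simeq> (clear u @ Zpow ?v) @ Zpow ?w"
    using braid_cong_append[OF Zpow_central[OF l(1)] braid_cong.refl] by simp
  also have "\<dots> \<simeq> (clear v @ Zpow ?u) @ Zpow ?w"
    by (rule braid_cong_append[OF trans.IH(1) braid_cong.refl])
  also have "\<dots> = (clear v @ Zpow ?w) @ Zpow ?u"
    using swap[of ?u ?w] by simp
  also have "\<dots> \<simeq> (clear w @ Zpow ?v) @ Zpow ?u"
    by (rule braid_cong_append[OF trans.IH(2) braid_cong.refl])
  also have "\<dots> \<simeq> Zpow ?v @ clear w @ Zpow ?u"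
    using braid_cong.sym[OF braid_cong_append[OF Zpow_central[OF l(3)] braid_cong.refl]] by simp
  finally show ?case
    by (rule left_cancel) (use l Zpow_lists in simp)
next
  case (cancel u v a b)
  let ?n = "negs u + negs v"
  have l: "clear u \<in> lists S" "clear v \<in> lists S" using cancel clear_lists by auto
  \<comment> \<open>Exactly one letter of the pair is inverse, whatever \<open>b\<close> is, so one
    central factor is introduced.\<close>
  have "negs [(a, b), (a, \<not> b)] = 1" by (simp add: negs_def)
  then have n: "negs (u @ [(a, b), (a, \<not> b)] @ v) = Suc 0 + ?n" by (simp only: negs_append)
  have "clear u @ clear [(a, b), (a, \<not> b)] @ clear v @ Zpow ?n
      \<simeq> clear u @ (D @ D) @ clear v @ Zpow ?n"
    using clear_cancel[OF cancel(3)] by (intro braid_cong_append braid_cong.refl)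
  also have "\<dots> \<simeq> clear u @ (clear v @ Zpow (Suc 0)) @ Zpow ?n"
    using braid_cong_context[OF Zpow_central[OF l(2), of "Suc 0"], of "clear u" "Zpow ?n"]
    by (simp add: Zpow_simps)
  finally show ?case
    unfolding n by (simp only: clear_append negs_append Zpow_add append_assoc)
next
  case (rel u v l r)
  from rel.hyps(5) obtain s t where st: "s \<in> S" "t \<in> S" "s \<noteq> t"
    "l = pos_word (alternating s t (cox_ord s t))" "r = pos_word (alternating t s (cox_ord s t))"
    unfolding braid_rels_def by blast
  have "clear u @ clear l @ clear v @ Zpow (negs u + negs v)
      \<simeq> clear u @ clear r @ clear v @ Zpow (negs u + negs v)"
    using braid_cong.braid[OF st(1-3)] by (simp add: st)
  then show ?case by (simp add: clear_append negs_append st)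
qed simp

text \<open>Positive words contain no inverse letters, so both denominators in
  \<open>clear_pres_rel\<close> are empty.\<close>

lemma br_inj: "br us = br vs \<Longrightarrow> us \<in> lists S \<Longrightarrow> vs \<in> lists S \<Longrightarrow> us \<simeq> vs"
  using clear_pres_rel[of "pos_word us" "pos_word vs"]
  by (simp add: br_eq_iff_pres_rel Zpow_simps)

subsection \<open>Rational permutation braids\<close>

lemma artin_monoid_eq: "artin_monoid W S = br ` lists S"
proof
  have "submonoid (br ` lists S) B"
  proof
    show "br ` lists S \<subseteq> carrier B" by (rule image_subsetI) (rule br_closed)
    show "\<one>\<^bsub>B\<^esub> \<in> br ` lists S"
      by (rule image_eqI[of _ _ "[]"]) (simp_all add: br_def)
    fix x y assume "x \<in> br ` lists S" "y \<in> br ` lists S"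
    then obtain us vs where "us \<in> lists S" "x = br us" "vs \<in> lists S" "y = br vs"
      by (elim imageE)
    then show "x \<otimes>\<^bsub>B\<^esub> y \<in> br ` lists S"
      by (intro image_eqI[of _ _ "us @ vs"]) (simp_all add: br_append)
  qed
  moreover have "artin_gen W S ` S \<subseteq> br ` lists S"
  proof
    fix x assume "x \<in> artin_gen W S ` S"
    then obtain s where s: "s \<in> S" "x = artin_gen W S s" by (elim imageE)
    then have "x = br [s]" using artin_gen_closed[of "[s]"] by (simp add: br_def)
    then show "x \<in> br ` lists S" using s by (intro image_eqI[of _ _ "[s]"]) simp_all
  qed
  ultimately show "artin_monoid W S \<subseteq> br ` lists S"
    unfolding artin_monoid_def by (intro hull_minimal)
  show "br ` lists S \<subseteq> artin_monoid W S"
  proof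
    fix x assume "x \<in> br ` lists S"
    then obtain ws where ws: "ws \<in> lists S" "x = br ws" by (elim imageE)
    have "br ws \<in> M" if "submonoid M B" "artin_gen W S ` S \<subseteq> M" for M
      using ws(1)
    proof (induction ws)
      case Nil
      then show ?case using submonoid.one_closed[OF that(1)] by (simp add: br_def)
    next
      case (Cons s ws)
      then show ?case using submonoid.m_closed[OF that(1)] that(2) by (auto simp: br_def)
    qed
    then show "x \<in> artin_monoid W S" by (auto simp: artin_monoid_def hull_def ws)
  qed
qed

lemma positive_lifts_eq: "positive_lifts W S = br ` {ws. reduced ws}"
  by (auto simp: positive_lifts_def is_lift_def reduced_expr_iff br_def)

lemma garside_element_eq: "garside_element W S = br D"
  unfolding garside_element_def
proof (rule the_equality)
  show "is_lift W S w0 (br D)"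
    using D_reduced by (auto simp: is_lift_def reduced_expr_iff br_def)
  fix b assume "is_lift W S w0 b"
  then obtain ws where "reduced ws" "pr ws = w0" "b = br ws"
    by (auto simp: is_lift_def reduced_expr_iff br_def)
  then show "b = br D"
    using br_cong[OF Matsumoto] D_reduced reduced_lists by metis
qed

lemma rational_permutation_braid_iff:
  assumes "\<beta> \<in> carrier B"
  shows "rational_permutation_braid W S \<beta> \<longleftrightarrow>
    br D \<otimes>\<^bsub>B\<^esub> \<beta> \<in> br ` lists S \<and> inv\<^bsub>B\<^esub> \<beta> \<otimes>\<^bsub>B\<^esub> br D \<in> br ` lists S"
  using assms D_reduced(3)
  by (simp add: rational_permutation_braid_def artin_le_def artin_monoid_eq garside_element_eq)

lemma rational_imp_fractions:
  assumes \<beta>: "\<beta> \<in> carrier B" and "rational_permutation_braid W S \<beta>"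
  shows "\<exists>xs ys. reduced xs \<and> reduced ys \<and> \<beta> = inv\<^bsub>B\<^esub> br xs \<otimes>\<^bsub>B\<^esub> br ys"
    and "\<exists>xs ys. reduced xs \<and> reduced ys \<and> \<beta> = br xs \<otimes>\<^bsub>B\<^esub> inv\<^bsub>B\<^esub> br ys"
proof -
  note D = D_reduced(3)
  have rat: "br D \<otimes>\<^bsub>B\<^esub> \<beta> \<in> br ` lists S" "inv\<^bsub>B\<^esub> \<beta> \<otimes>\<^bsub>B\<^esub> br D \<in> br ` lists S"
    using assms by (simp_all add: rational_permutation_braid_iff)
  from rat(1) obtain as where as: "as \<in> lists S" "br as = br D \<otimes>\<^bsub>B\<^esub> \<beta>"
    by (elim imageE) simp
  from rat(2) obtain bs where bs: "bs \<in> lists S" "br bs = inv\<^bsub>B\<^esub> \<beta> \<otimes>\<^bsub>B\<^esub> br D"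
    by (elim imageE) simp
  \<comment> \<open>The inner \<beta> and its inverse cancel.\<close>
  have "br (as @ bs) = br (D @ D)"
    using as bs \<beta> D by (simp add: br_append B.m_assoc)
  then have ab: "as @ bs \<simeq> D @ D" using br_inj as bs D by simp
  have "as @ (bs @ as) \<simeq> (D @ D) @ as"
    using braid_cong_append[OF ab braid_cong.refl] by simp
  also have "\<dots> \<simeq> as @ (D @ D)" by (rule D_square_central[OF as(1)])
  \<comment> \<open>Centrality of \<open>D @ D\<close> and cancellation of \<open>as\<close> give
    the product in the other order, so \<open>as\<close> too is a right divisor of
    \<open>D @ D\<close>.\<close>
  finally have ba: "bs @ as \<simeq> D @ D" by (rule left_cancel) (use as bs in simp)
  show "\<exists>xs ys. reduced xs \<and> reduced ys \<and> \<beta> = inv\<^bsub>B\<^esub> br xs \<otimes>\<^bsub>B\<^esub> br ys"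
  proof -
    obtain xs ys where xy: "reduced xs" "reduced ys" "as \<simeq> xs @ ys"
      using simple_pair_suffix[OF ba _ D_reduced(1) D_reduced(1)] as bs by auto
    \<comment> \<open>Completing \<open>xs\<close> to \<open>D\<close> on the right lets
      \<open>xs\<close> cancel from both sides of \<open>D \<beta> = xs ys\<close>, leaving
      \<open>vs \<beta> = ys\<close>.\<close>
    obtain vs where vs: "reduced vs" "D \<simeq> xs @ vs" using D_prefix[OF xy(1)] by blast
    note l = reduced_lists[OF xy(1)] reduced_lists[OF xy(2)] reduced_lists[OF vs(1)]
    have "br D \<otimes>\<^bsub>B\<^esub> \<beta> = br xs \<otimes>\<^bsub>B\<^esub> br ys"
      using br_cong[OF xy(3) as(1)] as(2) l by (simp add: br_append)
    moreover have "br D = br xs \<otimes>\<^bsub>B\<^esub> br vs"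
      using br_cong[OF vs(2) D] l by (simp add: br_append)
    ultimately have "br vs \<otimes>\<^bsub>B\<^esub> \<beta> = br ys"
      using l \<beta> by (simp add: B.m_assoc)
    then have "\<beta> = inv\<^bsub>B\<^esub> br vs \<otimes>\<^bsub>B\<^esub> br ys"
      using l \<beta> B.inv_cancel(1)[of "br vs" \<beta>] by simp
    then show ?thesis using vs xy by blast
  qed
  show "\<exists>xs ys. reduced xs \<and> reduced ys \<and> \<beta> = br xs \<otimes>\<^bsub>B\<^esub> inv\<^bsub>B\<^esub> br ys"
  proof -
    obtain xs ys where xy: "reduced xs" "reduced ys" "bs \<simeq> xs @ ys"
      using simple_pair_suffix[OF ab _ D_reduced(1) D_reduced(1)] as bs by auto
    \<comment> \<open>Here \<open>ys\<close> is completed on the left and cancelled on the right;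
      the numerator is \<open>vs\<close> and the denominator is \<open>xs\<close>.\<close>
    obtain vs where vs: "reduced vs" "D \<simeq> vs @ ys" using D_suffix[OF xy(2)] by blast
    note l = reduced_lists[OF xy(1)] reduced_lists[OF xy(2)] reduced_lists[OF vs(1)]
    have "inv\<^bsub>B\<^esub> \<beta> \<otimes>\<^bsub>B\<^esub> br D = br xs \<otimes>\<^bsub>B\<^esub> br ys"
      using br_cong[OF xy(3) bs(1)] bs(2) l by (simp add: br_append)
    moreover have "br D = br vs \<otimes>\<^bsub>B\<^esub> br ys"
      using br_cong[OF vs(2) D] l by (simp add: br_append)
    ultimately have "inv\<^bsub>B\<^esub> \<beta> \<otimes>\<^bsub>B\<^esub> br vs = br xs"
      using l \<beta> B.right_cancel[of "br ys" "inv\<^bsub>B\<^esub> \<beta> \<otimes>\<^bsub>B\<^esub> br vs" "br xs"] by (simp add: B.m_assoc)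
    then have "\<beta> \<otimes>\<^bsub>B\<^esub> br xs = br vs"
      using l \<beta> B.inv_cancel(2)[of \<beta> "br vs"] by simp
    then have "\<beta> = br vs \<otimes>\<^bsub>B\<^esub> inv\<^bsub>B\<^esub> br xs"
      using l \<beta> B.inv_solve_right[of \<beta> "br vs" "br xs"] by simp
    then show ?thesis using vs xy by blast
  qed
qed

text \<open>With \<open>D = vs xs = ys zs\<close>, the first bound gives
  \<open>D xs^-1 ys = vs ys\<close>. For the second,
  \<open>ys^-1 xs D = ys^-1 D (tau xs) = zs (tau xs)\<close>.\<close>

lemma left_fraction_imp_rational:
  assumes "reduced xs" "reduced ys"
  shows "rational_permutation_braid W S (inv\<^bsub>B\<^esub> br xs \<otimes>\<^bsub>B\<^esub> br ys)"
proof -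
  note D = D_reduced(3)
  obtain vs zs where vs: "reduced vs" "D \<simeq> vs @ xs" and zs: "reduced zs" "D \<simeq> ys @ zs"
    using D_suffix[OF assms(1)] D_prefix[OF assms(2)] by blast
  note l = reduced_lists[OF assms(1)] reduced_lists[OF assms(2)] reduced_lists[OF vs(1)]
    reduced_lists[OF zs(1)] tau_lists[OF reduced_lists[OF assms(1)]]
  have Dv: "br D = br vs \<otimes>\<^bsub>B\<^esub> br xs" and Dz: "br D = br ys \<otimes>\<^bsub>B\<^esub> br zs"
    using br_cong[OF vs(2) D] br_cong[OF zs(2) D] l by (simp_all add: br_append)
  have xD: "br xs \<otimes>\<^bsub>B\<^esub> br D = br D \<otimes>\<^bsub>B\<^esub> br (map tau xs)"
    using br_cong[OF D_shift] l D by (simp add: br_append[symmetric])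
  have "br D \<otimes>\<^bsub>B\<^esub> (inv\<^bsub>B\<^esub> br xs \<otimes>\<^bsub>B\<^esub> br ys) = br (vs @ ys)"
    unfolding Dv using l by (simp add: B.m_assoc br_append)
  moreover have "inv\<^bsub>B\<^esub> (inv\<^bsub>B\<^esub> br xs \<otimes>\<^bsub>B\<^esub> br ys) \<otimes>\<^bsub>B\<^esub> br D = br (zs @ map tau xs)"
    using l D xD by (simp add: B.inv_mult_group B.m_assoc br_append) (simp add: Dz B.m_assoc)
  moreover have "vs @ ys \<in> lists S" "zs @ map tau xs \<in> lists S" using l by simp_all
  ultimately show ?thesis
    using l by (subst rational_permutation_braid_iff) auto
qed

text \<open>With \<open>D = vs ys = xs zs\<close>, the twist by \<open>tau\<close> is now needed for
  the first bound: \<open>D xs ys^-1 = (tau xs) D ys^-1 = (tau xs) vs\<close>. The second is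
  \<open>ys xs^-1 D = ys zs\<close>.\<close>

lemma right_fraction_imp_rational:
  assumes "reduced xs" "reduced ys"
  shows "rational_permutation_braid W S (br xs \<otimes>\<^bsub>B\<^esub> inv\<^bsub>B\<^esub> br ys)"
proof -
  note D = D_reduced(3)
  obtain vs zs where vs: "reduced vs" "D \<simeq> vs @ ys" and zs: "reduced zs" "D \<simeq> xs @ zs"
    using D_suffix[OF assms(2)] D_prefix[OF assms(1)] by blast
  note l = reduced_lists[OF assms(1)] reduced_lists[OF assms(2)] reduced_lists[OF vs(1)]
    reduced_lists[OF zs(1)] tau_lists[OF reduced_lists[OF assms(1)]]
  have Dv: "br D = br vs \<otimes>\<^bsub>B\<^esub> br ys" and Dz: "br D = br xs \<otimes>\<^bsub>B\<^esub> br zs"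
    using br_cong[OF vs(2) D] br_cong[OF zs(2) D] l by (simp_all add: br_append)
  have Dx: "br D \<otimes>\<^bsub>B\<^esub> br xs = br (map tau xs) \<otimes>\<^bsub>B\<^esub> br D"
    using br_cong[OF D_shift'] l D by (simp add: br_append[symmetric])
  have "br D \<otimes>\<^bsub>B\<^esub> (br xs \<otimes>\<^bsub>B\<^esub> inv\<^bsub>B\<^esub> br ys) = br (map tau xs) \<otimes>\<^bsub>B\<^esub> br D \<otimes>\<^bsub>B\<^esub> inv\<^bsub>B\<^esub> br ys"
    using l D Dx by (simp flip: B.m_assoc)
  also have "\<dots> = br (map tau xs @ vs)"
    unfolding Dv using l by (simp add: B.m_assoc br_append)
  finally have "br D \<otimes>\<^bsub>B\<^esub> (br xs \<otimes>\<^bsub>B\<^esub> inv\<^bsub>B\<^esub> br ys) = br (map tau xs @ vs)" .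
  moreover have "inv\<^bsub>B\<^esub> (br xs \<otimes>\<^bsub>B\<^esub> inv\<^bsub>B\<^esub> br ys) \<otimes>\<^bsub>B\<^esub> br D = br (ys @ zs)"
    unfolding Dz using l by (simp add: B.inv_mult_group B.m_assoc br_append)
  moreover have "map tau xs @ vs \<in> lists S" "ys @ zs \<in> lists S" using l by simp_all
  ultimately show ?thesis
    using l by (subst rational_permutation_braid_iff) auto
qed

end

theorem proposition4p3:
  fixes W :: "('a, 'b) monoid_scheme" and S :: "'a set" and \<beta> :: "'a gword set"
  assumes "coxeter_system W S" and "finite (carrier W)"
    and "\<beta> \<in> carrier (artin_group W S)"
  shows "(rational_permutation_braid W S \<beta> \<longleftrightarrow>
            (\<exists>x\<in>positive_lifts W S. \<exists>y\<in>positive_lifts W S.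
               \<beta> = inv\<^bsub>artin_group W S\<^esub> x \<otimes>\<^bsub>artin_group W S\<^esub> y)) \<and>
         (rational_permutation_braid W S \<beta> \<longleftrightarrow>
            (\<exists>x\<in>positive_lifts W S. \<exists>y\<in>positive_lifts W S.
               \<beta> = x \<otimes>\<^bsub>artin_group W S\<^esub> inv\<^bsub>artin_group W S\<^esub> y))"
proof -
  interpret finite_coxeter W S by unfold_locales (use assms in auto)
  show ?thesis
    unfolding positive_lifts_eq
    using rational_imp_fractions[OF assms(3)] left_fraction_imp_rational
      right_fraction_imp_rational
    by blast
qed

end
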